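(* Let $\mathcal P$ be a chiral or directly regular $n$-polytope of type $\{p_1, \ldots, p_{n-1}\}$, and suppose that $n$ is even, $n\ge 4$. Let $m = n/2$, and suppose that $p_{m-1}$ and $p_{m+1}$ are relatively prime, and that $p_m \geq 3$. Then $\mathcal P \diamond \mathcal P^{\delta}$ is not a polytope.
   Context: An abstract polytope of rank $n$ (an $n$-polytope) is a ranked poset of faces with ranks from $-1$ to $n$, with a unique least face (rank $-1$) and a unique greatest face (rank $n$), in which every flag (maximal chain) has $n+2$ faces, which satisfies the diamond condition (whenever $F<G$ with ranks $j-1$ and $j+1$ there are exactly two $j$-faces strictly between them), and which is strongly flag-connected (any two flags $\Phi,\Psi$ are joined by a sequence of flags, consecutive ones adjacent, all containing $\Phi\cap\Psi$; two flags are adjacent if they differ in exactly one face). $\Phi^j$ denotes the unique flag differing from $\Phi$ only in its $j$-face, and $\Phi^{i,j}=(\Phi^i)^j$. Each polytope considered has a fixed base flag $\Phi$. $\mathcal P$ is regular if its automorphism group $\Gamma(\mathcal P)$ is transitive on flags; then $\Gamma(\mathcal P)$ is generated by $\rho_0,\dots,\rho_{n-1}$, where $\rho_i$ maps $\Phi$ to $\Phi^i$. Put $\sigma_i=\rho_{i-1}\rho_i$ and $\Gamma^+(\mathcal P)=\langle\sigma_1,\dots,\sigma_{n-1}\rangle$; $\mathcal P$ is directly regular if it is regular and $\Gamma^+(\mathcal P)$ has index $2$ in $\Gamma(\mathcal P)$. $\mathcal P$ is chiral if $\Gamma(\mathcal P)$ has exactly two orbits on flags and adjacent flags lie in distinct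 orbits; then $\Gamma^+(\mathcal P):=\Gamma(\mathcal P)$ is generated by $\sigma_1,\dots,\sigma_{n-1}$, where $\sigma_i$ maps $\Phi$ to $\Phi^{i,i-1}$. In both cases $(\sigma_i\cdots\sigma_j)^2=1$ for $i<j$, and the type of $\mathcal P$ is $\{p_1,\dots,p_{n-1}\}$ where $p_i$ (with $2\le p_i\le\infty$) is the order of $\sigma_i$. Dual: $\mathcal P^\delta$ is $\mathcal P$ with reversed order; $\Gamma^+(\mathcal P^\delta)$ is the same group with specified generators $\sigma_i'=\sigma_{n-i}^{-1}$, $i=1,\dots,n-1$. Intersection property: for a group $G$ with specified generators $\sigma_1,\dots,\sigma_{n-1}$, put $\tau_{i,j}=\sigma_i\cdots\sigma_j$ ($1\le i\le j\le n-1$) and, for $I\subseteq\{0,\dots,n-1\}$, $G_I=\langle\tau_{i,j}\mid i\le j,\ i-1,j\in I\rangle$. $G$ has the intersection property if $G_I\cap G_J=G_{I\cap J}$ for all $I,J$. Mix: $\Gamma^+(\mathcal P)\diamond\Gamma^+(\mathcal Q)$ is the subgroup of $\Gamma^+(\mathcal P)\times\Gamma^+(\mathcal Q)$ generated by $\beta_i=(\sigma_i,\sigma_i')$, where $\sigma_i,\sigma_i'$ are the specified generators of the two groups. $\mathcal P\diamond\mathcal Q$ is the flag-connected pre-polytope (polytope axioms with strong flag-connectedness weakened to flag-connectedness) built from this group, with $\Gamma^+(\mathcal P\diamond\mathcal Q)=\Gamma^+(\mathcal P)\diamond\Gamma^+(\mathcal Q)$; it is a polytope if and only if this group with generators $\beta_i$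 has the intersection property. *)

theory Defs
  imports
    "HOL-Algebra.Multiplicative_Group"
    "HOL-Algebra.Generated_Groups"
    "HOL-Algebra.Bij"
    "HOL-Library.Extended_Nat"
begin

section \<open>Abstract polytopes\<close>

text \<open>The set of faces is the field of the (reflexive) order relation.\<close>

record 'f ranked_poset =
  le_rel :: "'f rel"
  rk :: "'f \<Rightarrow> int"

definition faces :: "'f ranked_poset \<Rightarrow> 'f set" where
  "faces P = Field (le_rel P)"

definition face_less :: "'f ranked_poset \<Rightarrow> 'f \<Rightarrow> 'f \<Rightarrow> bool" where
  "face_less P F G \<longleftrightarrow> (F, G) \<in> le_rel P \<and> F \<noteq> G"

definition is_ranked :: "nat \<Rightarrow> 'f ranked_poset \<Rightarrow> bool" where
  "is_ranked n P \<longleftrightarrow>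
     Partial_order (le_rel P) \<and>
     (\<forall>F \<in> faces P. - 1 \<le> rk P F \<and> rk P F \<le> int n) \<and>
     (\<forall>F G. face_less P F G \<longrightarrow> rk P F < rk P G) \<and>
     (\<forall>F G. face_less P F G \<and> (\<nexists>H. face_less P F H \<and> face_less P H G)
            \<longrightarrow> rk P G = rk P F + 1)"

definition bounded_faces :: "nat \<Rightarrow> 'f ranked_poset \<Rightarrow> bool" where
  "bounded_faces n P \<longleftrightarrow>
     (\<exists>L \<in> faces P. rk P L = - 1 \<and> (\<forall>F \<in> faces P. (L, F) \<in> le_rel P)) \<and>
     (\<exists>T \<in> faces P. rk P T = int n \<and> (\<forall>F \<in> faces P. (F, T) \<in> le_rel P))"

definition flag :: "'f ranked_poset \<Rightarrow> 'f set \<Rightarrow> bool" where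
  "flag P C \<longleftrightarrow> C \<in> Chains (le_rel P) \<and> (\<forall>D \<in> Chains (le_rel P). C \<subseteq> D \<longrightarrow> D = C)"

definition adjacent :: "'f set \<Rightarrow> 'f set \<Rightarrow> bool" where
  "adjacent A B \<longleftrightarrow> card (A - B) = 1 \<and> card (B - A) = 1"

definition diamond :: "'f ranked_poset \<Rightarrow> bool" where
  "diamond P \<longleftrightarrow>
     (\<forall>F G. face_less P F G \<and> rk P G = rk P F + 2
            \<longrightarrow> card {H. face_less P F H \<and> face_less P H G \<and> rk P H = rk P F + 1} = 2)"

definition strongly_flag_connected :: "'f ranked_poset \<Rightarrow> bool" where
  "strongly_flag_connected P \<longleftrightarrow>
     (\<forall>A B. flag P A \<and> flag P B \<longrightarrow>
        (\<lambda>C D. flag P D \<and> adjacent C D \<and> A \<inter> B \<subseteq> D)\<^sup>*\<^sup>* A B)"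

definition polytope :: "nat \<Rightarrow> 'f ranked_poset \<Rightarrow> bool" where
  "polytope n P \<longleftrightarrow>
     is_ranked n P \<and> bounded_faces n P \<and>
     (\<forall>C. flag P C \<longrightarrow> card C = n + 2) \<and>
     diamond P \<and> strongly_flag_connected P"

definition dual :: "nat \<Rightarrow> 'f ranked_poset \<Rightarrow> 'f ranked_poset" where
  "dual n P = \<lparr>le_rel = (le_rel P)\<inverse>, rk = (\<lambda>F. int n - 1 - rk P F)\<rparr>"

definition adj_flag :: "'f ranked_poset \<Rightarrow> 'f set \<Rightarrow> int \<Rightarrow> 'f set" where
  "adj_flag P C j =
     (THE D. flag P D \<and> D \<noteq> C \<and> {F \<in> D. rk P F \<noteq> j} = {F \<in> C. rk P F \<noteq> j})"

section \<open>Automorphisms, regularity and chirality\<close>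

text \<open>Automorphisms act on the right: \<open>f \<otimes> g\<close> is ``first \<open>f\<close>, then \<open>g\<close>''. With this
  convention \<open>\<rho>\<^bsub>i-1\<^esub> \<otimes> \<rho>\<^bsub>i\<^esub>\<close> maps the base flag \<open>C\<close> to \<open>(C\<^sup>i)\<^bsup>i-1\<^esup>\<close>.\<close>

definition aut_group :: "'f ranked_poset \<Rightarrow> ('f \<Rightarrow> 'f) monoid" where
  "aut_group P =
     \<lparr>carrier = {f \<in> Bij (faces P).
                  \<forall>F \<in> faces P. \<forall>G \<in> faces P. (f F, f G) \<in> le_rel P \<longleftrightarrow> (F, G) \<in> le_rel P},
      mult = (\<lambda>f g. compose (faces P) g f),
      one = (\<lambda>F \<in> faces P. F)\<rparr>"

definition flag_orbit :: "'f ranked_poset \<Rightarrow> 'f set \<Rightarrow> 'f set set" where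
  "flag_orbit P C = (\<lambda>f. f ` C) ` carrier (aut_group P)"

definition regular :: "'f ranked_poset \<Rightarrow> bool" where
  "regular P \<longleftrightarrow> (\<forall>C D. flag P C \<and> flag P D \<longrightarrow> D \<in> flag_orbit P C)"

definition chiral :: "'f ranked_poset \<Rightarrow> bool" where
  "chiral P \<longleftrightarrow>
     card (flag_orbit P ` {C. flag P C}) = 2 \<and>
     (\<forall>C D. flag P C \<and> flag P D \<and> adjacent C D \<longrightarrow> flag_orbit P C \<noteq> flag_orbit P D)"

definition aut_to :: "'f ranked_poset \<Rightarrow> 'f set \<Rightarrow> 'f set \<Rightarrow> 'f \<Rightarrow> 'f" where
  "aut_to P C D = (THE f. f \<in> carrier (aut_group P) \<and> f ` C = D)"

definition rho :: "'f ranked_poset \<Rightarrow> 'f set \<Rightarrow> int \<Rightarrow> 'f \<Rightarrow> 'f" where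
  "rho P C i = aut_to P C (adj_flag P C i)"

definition sigma :: "'f ranked_poset \<Rightarrow> 'f set \<Rightarrow> nat \<Rightarrow> 'f \<Rightarrow> 'f" where
  "sigma P C i =
     (if regular P then rho P C (int i - 1) \<otimes>\<^bsub>aut_group P\<^esub> rho P C (int i)
      else aut_to P C (adj_flag P (adj_flag P C (int i)) (int i - 1)))"

definition rot_group :: "nat \<Rightarrow> 'f ranked_poset \<Rightarrow> 'f set \<Rightarrow> ('f \<Rightarrow> 'f) monoid" where
  "rot_group n P C =
     (if regular P
      then (aut_group P)\<lparr>carrier := generate (aut_group P) (sigma P C ` {1..n - 1})\<rparr>
      else aut_group P)"

definition directly_regular :: "nat \<Rightarrow> 'f ranked_poset \<Rightarrow> 'f set \<Rightarrow> bool" where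
  "directly_regular n P C \<longleftrightarrow>
     regular P \<and> card (rcosets\<^bsub>aut_group P\<^esub> carrier (rot_group n P C)) = 2"

text \<open>The library's \<open>group.ord\<close> is \<open>0\<close> on elements of infinite order.\<close>

definition elem_order :: "('g, 'b) monoid_scheme \<Rightarrow> 'g \<Rightarrow> enat" where
  "elem_order G x = (if group.ord G x = 0 then \<infinity> else enat (group.ord G x))"

definition has_type :: "nat \<Rightarrow> 'f ranked_poset \<Rightarrow> 'f set \<Rightarrow> (nat \<Rightarrow> enat) \<Rightarrow> bool" where
  "has_type n P C p \<longleftrightarrow> (\<forall>i \<in> {1..n - 1}. p i = elem_order (aut_group P) (sigma P C i))"

definition relatively_prime :: "enat \<Rightarrow> enat \<Rightarrow> bool" where
  "relatively_prime x y \<longleftrightarrow> (\<exists>a b :: nat. x = enat a \<and> y = enat b \<and> coprime a b)"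

section \<open>The mix\<close>

definition tau :: "('g, 'b) monoid_scheme \<Rightarrow> (nat \<Rightarrow> 'g) \<Rightarrow> nat \<Rightarrow> nat \<Rightarrow> 'g" where
  "tau G s i j = foldr (\<lambda>k x. s k \<otimes>\<^bsub>G\<^esub> x) [i..<Suc j] \<one>\<^bsub>G\<^esub>"

definition sub_gen :: "nat \<Rightarrow> ('g, 'b) monoid_scheme \<Rightarrow> (nat \<Rightarrow> 'g) \<Rightarrow> int set \<Rightarrow> 'g set" where
  "sub_gen n G s I =
     generate G {tau G s i j |i j. 1 \<le> i \<and> i \<le> j \<and> j \<le> n - 1 \<and> int i - 1 \<in> I \<and> int j \<in> I}"

text \<open>The poset built from a group \<open>G\<close> with generators \<open>s\<^sub>1, \<dots>, s\<^bsub>n-1\<^esub>\<close> in the way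
  of Schulte and Weiss: the \<open>i\<close>-faces are the right cosets of \<open>G\<^sub>I\<close> with
  \<open>I = {0, \<dots>, n-1} - {i}\<close>, and incident faces are those which meet as cosets. For
  \<open>i = -1\<close> and \<open>i = n\<close> the subgroup is all of \<open>G\<close>, which yields the two improper faces;
  the rank is recorded in the first component to keep cosets for different \<open>i\<close> apart.\<close>

definition coset_faces :: "nat \<Rightarrow> ('g, 'b) monoid_scheme \<Rightarrow> (nat \<Rightarrow> 'g) \<Rightarrow> (int \<times> 'g set) set" where
  "coset_faces n G s =
     (SIGMA i : {- 1..int n}. rcosets\<^bsub>G\<^esub> (sub_gen n G s ({0..int n - 1} - {i})))"

definition coset_poset :: "nat \<Rightarrow> ('g, 'b) monoid_scheme \<Rightarrow> (nat \<Rightarrow> 'g) \<Rightarrow> (int \<times> 'g set) ranked_poset" where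
  "coset_poset n G s =
     \<lparr>le_rel = {((i, A), (j, B)). (i, A) \<in> coset_faces n G s \<and> (j, B) \<in> coset_faces n G s \<and>
                                   i \<le> j \<and> A \<inter> B \<noteq> {}},
      rk = fst\<rparr>"

definition mix_gen ::
  "'f ranked_poset \<Rightarrow> 'f set \<Rightarrow> 'h ranked_poset \<Rightarrow> 'h set \<Rightarrow> nat \<Rightarrow> ('f \<Rightarrow> 'f) \<times> ('h \<Rightarrow> 'h)" where
  "mix_gen P C Q D i = (sigma P C i, sigma Q D i)"

definition mix_group ::
  "nat \<Rightarrow> 'f ranked_poset \<Rightarrow> 'f set \<Rightarrow> 'h ranked_poset \<Rightarrow> 'h set \<Rightarrow> (('f \<Rightarrow> 'f) \<times> ('h \<Rightarrow> 'h)) monoid" where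
  "mix_group n P C Q D =
     (rot_group n P C \<times>\<times> rot_group n Q D)
       \<lparr>carrier := generate (rot_group n P C \<times>\<times> rot_group n Q D) (mix_gen P C Q D ` {1..n - 1})\<rparr>"

definition mix ::
  "nat \<Rightarrow> 'f ranked_poset \<Rightarrow> 'f set \<Rightarrow> 'h ranked_poset \<Rightarrow> 'h set
     \<Rightarrow> (int \<times> (('f \<Rightarrow> 'f) \<times> ('h \<Rightarrow> 'h)) set) ranked_poset" where
  "mix n P C Q D = coset_poset n (mix_group n P C Q D) (mix_gen P C Q D)"

end

theory Submission
  imports Defs
begin

text \<open>
  Let \<open>s\<^sub>i\<close> be the generators of \<open>\<Gamma>\<^sup>+(P)\<close>, so that \<open>b\<^sub>i = (s\<^sub>i, s\<^bsub>n-i\<^esub>\<^sup>-\<^sup>1)\<close> generate the mix, and let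
  \<open>H\<^sub>k\<close> be the subgroup whose cosets are the \<open>k\<close>-faces. Since \<open>p\<^bsub>m-1\<^esub>\<close> and \<open>p\<^bsub>m+1\<^esub>\<close> are coprime,
  \<open>(s\<^bsub>m-1\<^esub>, 1)\<close> and \<open>(s\<^bsub>m+1\<^esub>, 1)\<close> are powers of \<open>b\<^bsub>m-1\<^esub>\<close> and \<open>b\<^bsub>m+1\<^esub>\<close>. As \<open>s\<^bsub>m-1\<^esub>s\<^sub>m\<close> and \<open>s\<^sub>ms\<^bsub>m+1\<^esub>\<close>
  are involutions, \<open>x = (1, s\<^sub>m\<^sup>-\<^sup>2)\<close> is the square of both \<open>(s\<^bsub>m-1\<^esub>, 1)b\<^sub>m\<close> and \<open>b\<^sub>m(s\<^bsub>m+1\<^esub>, 1)\<close>,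
  hence lies in every \<open>H\<^sub>k\<close> with \<open>k \<noteq> m - 1, m\<close>.

  If the mix were a polytope, strong flag-connectedness would join the base flag to its translate
  by \<open>x\<close> through flags which change only in ranks \<open>m - 1\<close> and \<open>m\<close>. By the diamond condition such
  a path runs through the translates, by powers of \<open>b\<^sub>m\<close>, of the base flag and of its \<open>m\<close>-adjacent
  flag. So for some power \<open>g\<close> of \<open>b\<^sub>m\<close> the first component of \<open>xg\<^sup>-\<^sup>1\<close>, a power of \<open>s\<^sub>m\<close>, maps \<open>\<Phi>\<close> to
  \<open>\<Phi>\<close> or to \<open>\<Phi>\<^sup>m\<close>. In the first case \<open>x = g\<close>; in the second case \<open>s\<^sub>m\<close> commutes with an automorphism
  acting as a reflection that inverts it. Both give \<open>s\<^sub>m\<^sup>2 = 1\<close>, contradicting \<open>p\<^sub>m \<ge> 3\<close>.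
\<close>

section \<open>Flags\<close>

lemma chain_iff:
  "C \<in> Chains r \<longleftrightarrow> (\<forall>F\<in>C. \<forall>G\<in>C. (F, G) \<in> r \<or> (G, F) \<in> r)"
  by (auto simp: Chains_def)

definition face :: "'f ranked_poset \<Rightarrow> 'f set \<Rightarrow> int \<Rightarrow> 'f" where
  "face P C j = (THE F. F \<in> C \<and> rk P F = j)"

locale abstract_polytope =
  fixes n :: nat and P :: "'f ranked_poset"
  assumes polytope: "polytope n P"
begin

lemma partial_order: "Partial_order (le_rel P)"
  using polytope by (simp add: polytope_def is_ranked_def)

lemma le_refl: "F \<in> faces P \<Longrightarrow> (F, F) \<in> le_rel P"
  using partial_order by (auto simp: order_on_defs faces_def refl_on_def)

lemma le_trans: "(F, G) \<in> le_rel P \<Longrightarrow> (G, H) \<in> le_rel P \<Longrightarrow> (F, H) \<in> le_rel P"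
  using partial_order unfolding order_on_defs trans_def by blast

lemma le_faces: "(F, G) \<in> le_rel P \<Longrightarrow> F \<in> faces P" "(F, G) \<in> le_rel P \<Longrightarrow> G \<in> faces P"
  unfolding faces_def by (auto intro: FieldI1 FieldI2)

lemma rk_bounds: "F \<in> faces P \<Longrightarrow> - 1 \<le> rk P F \<and> rk P F \<le> int n"
  using polytope by (simp add: polytope_def is_ranked_def)

lemma rk_strict: "(F, G) \<in> le_rel P \<Longrightarrow> F \<noteq> G \<Longrightarrow> rk P F < rk P G"
  using polytope by (simp add: polytope_def is_ranked_def face_less_def)

lemma rk_mono: "(F, G) \<in> le_rel P \<Longrightarrow> rk P F \<le> rk P G"
  using rk_strict[of F G] by (cases "F = G") auto

lemma chain_faces: "C \<in> Chains (le_rel P) \<Longrightarrow> C \<subseteq> faces P"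
  unfolding chain_iff using le_faces by blast

lemma chain_rk_inj: "C \<in> Chains (le_rel P) \<Longrightarrow> inj_on (rk P) C"
  unfolding chain_iff inj_on_def using rk_strict by (metis less_irrefl)

lemma chain_rk_range: "C \<in> Chains (le_rel P) \<Longrightarrow> rk P ` C \<subseteq> {- 1..int n}"
  using chain_faces rk_bounds by fastforce

lemma chain_finite: "C \<in> Chains (le_rel P) \<Longrightarrow> finite C"
  by (meson chain_rk_inj chain_rk_range finite_atLeastAtMost_int finite_imageD finite_subset)

lemma chain_card: "C \<in> Chains (le_rel P) \<Longrightarrow> card C \<le> n + 2"
  using card_mono[OF _ chain_rk_range[of C]] card_image[OF chain_rk_inj[of C]] by simp

lemma flag_chain: "flag P C \<Longrightarrow> C \<in> Chains (le_rel P)"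
  by (simp add: flag_def)

text \<open>The ranks on a chain are distinct and lie among \<open>n + 2\<close> integers; a flag
  has \<open>n + 2\<close> faces, so no rank is left out.\<close>

lemma flag_rk: assumes "flag P C" shows "rk P ` C = {- 1..int n}"
proof (rule card_subset_eq)
  show "rk P ` C \<subseteq> {- 1..int n}" using chain_rk_range flag_chain assms by blast
  have "card C = n + 2" using polytope assms by (simp add: polytope_def)
  then show "card (rk P ` C) = card {- 1..int n}"
    using card_image[OF chain_rk_inj[OF flag_chain[OF assms]]] by simp
qed simp

text \<open>Any face added to such a chain would repeat a rank, which cannot happen in a
  chain.\<close>

lemma flagI:
  assumes "C \<in> Chains (le_rel P)" "{- 1..int n} \<subseteq> rk P ` C"
  shows "flag P C"
  unfolding flag_def
proof (intro conjI ballI impI)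
  fix D assume D: "D \<in> Chains (le_rel P)" "C \<subseteq> D"
  show "D = C"
  proof (rule ccontr)
    assume "D \<noteq> C"
    then obtain F where F: "F \<in> D" "F \<notin> C" using D by blast
    have "rk P F \<in> rk P ` C" using chain_rk_range[OF D(1)] F assms by blast
    then obtain G where "G \<in> C" "rk P F = rk P G" by blast
    then show False using chain_rk_inj[OF D(1)] F D(2) by (metis inj_onD subsetD)
  qed
qed (fact assms)

section \<open>Faces of a flag indexed by rank\<close>

lemma face_eqI: "flag P C \<Longrightarrow> F \<in> C \<Longrightarrow> rk P F = j \<Longrightarrow> face P C j = F"
  unfolding face_def using chain_rk_inj[OF flag_chain] by (intro the_equality) (auto dest: inj_onD)

lemma face_in: "flag P C \<Longrightarrow> - 1 \<le> j \<Longrightarrow> j \<le> int n \<Longrightarrow> face P C j \<in> C"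
  and rk_face: "flag P C \<Longrightarrow> - 1 \<le> j \<Longrightarrow> j \<le> int n \<Longrightarrow> rk P (face P C j) = j"
proof -
  assume *: "flag P C" "- 1 \<le> j" "j \<le> int n"
  then have "j \<in> rk P ` C" using flag_rk by auto
  then obtain F where "F \<in> C" "rk P F = j" by blast
  then show "face P C j \<in> C" "rk P (face P C j) = j" using face_eqI * by auto
qed

lemma flag_faces: "flag P C \<Longrightarrow> F \<in> C \<Longrightarrow> F \<in> faces P"
  using chain_faces flag_chain by blast

lemma flag_eqI:
  assumes "flag P C" "flag P D" "\<And>j. - 1 \<le> j \<Longrightarrow> j \<le> int n \<Longrightarrow> face P C j = face P D j"
  shows "C = D"
proof -
  have "C \<subseteq> D" if "flag P C" "flag P D" "\<And>j. - 1 \<le> j \<Longrightarrow> j \<le> int n \<Longrightarrow> face P C j = face P D j" for C D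
  proof
    fix F assume F: "F \<in> C"
    then have b: "- 1 \<le> rk P F" "rk P F \<le> int n" using rk_bounds flag_faces that(1) by blast+
    have "face P C (rk P F) = F" using face_eqI that(1) F by blast
    then show "F \<in> D" using face_in[OF that(2) b] that(3)[OF b] by simp
  qed
  from this[OF assms] this[OF assms(2,1) assms(3)[symmetric]] show ?thesis by (rule equalityI)
qed

lemma face_le:
  assumes "flag P C" "- 1 \<le> i" "i \<le> j" "j \<le> int n"
  shows "(face P C i, face P C j) \<in> le_rel P"
proof -
  have i: "face P C i \<in> C" "rk P (face P C i) = i" using face_in rk_face assms by auto
  have j: "face P C j \<in> C" "rk P (face P C j) = j" using face_in rk_face assms by auto
  have "(face P C i, face P C j) \<in> le_rel P \<or> (face P C j, face P C i) \<in> le_rel P"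
    using flag_chain[OF assms(1)] i j unfolding chain_iff by blast
  then show ?thesis using rk_strict[of "face P C j" "face P C i"] i j assms(3) by (metis not_less)
qed

lemma least_face:
  assumes "flag P C" "flag P D" shows "face P C (- 1) = face P D (- 1)"
proof -
  obtain L where L: "L \<in> faces P" "rk P L = - 1" "\<forall>F \<in> faces P. (L, F) \<in> le_rel P"
    using polytope by (auto simp: polytope_def bounded_faces_def)
  have "face P C (- 1) = L" if "flag P C" for C
    using rk_face[OF that, of "-1"] face_in[OF that, of "-1"] flag_faces[OF that] L
      rk_strict[of L "face P C (- 1)"] by fastforce
  then show ?thesis using assms by simp
qed

lemma greatest_face:
  assumes "flag P C" "flag P D" shows "face P C (int n) = face P D (int n)"
proof -
  obtain L where L: "L \<in> faces P" "rk P L = int n" "\<forall>F \<in> faces P. (F, L) \<in> le_rel P"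
    using polytope by (auto simp: polytope_def bounded_faces_def)
  have "face P C (int n) = L" if "flag P C" for C
    using rk_face[OF that, of "int n"] face_in[OF that, of "int n"] flag_faces[OF that] L
      rk_strict[of "face P C (int n)" L] by fastforce
  then show ?thesis using assms by simp
qed

text \<open>The diamond condition in the form used to identify faces: once \<open>A\<close> is
  excluded, only one face of middle rank is left between \<open>F\<close> and
  \<open>G\<close>.\<close>

lemma diamond_three:
  assumes "rk P G = rk P F + 2" "rk P A = rk P F + 1" "rk P B = rk P F + 1" "rk P C = rk P F + 1"
    "(F, A) \<in> le_rel P" "(A, G) \<in> le_rel P"
    "(F, B) \<in> le_rel P" "(B, G) \<in> le_rel P"
    "(F, C) \<in> le_rel P" "(C, G) \<in> le_rel P" "B \<noteq> A" "C \<noteq> A"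
  shows "B = C"
proof (rule ccontr)
  assume "B \<noteq> C"
  let ?S = "{H. face_less P F H \<and> face_less P H G \<and> rk P H = rk P F + 1}"
  have "F \<noteq> G" "F \<noteq> A" "F \<noteq> B" "F \<noteq> C" "G \<noteq> A" "G \<noteq> B" "G \<noteq> C" using assms(1-4) by auto
  then have "{A, B, C} \<subseteq> ?S" using assms(2-10) by (simp add: face_less_def)
  moreover have "face_less P F G" using le_trans assms(5,6) \<open>F \<noteq> G\<close> unfolding face_less_def by blast
  then have c: "card ?S = 2" using polytope assms(1) unfolding polytope_def diamond_def by blast
  moreover have "finite ?S" using c by (intro card_ge_0_finite) (simp only: zero_less_numeral)
  ultimately have "card {A, B, C} \<le> 2" using card_mono[of ?S "{A, B, C}"] by simp
  then show False using assms(11,12) \<open>B \<noteq> C\<close> by auto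
qed

lemma face_diamond:
  assumes "flag P C" "flag P D" "flag P E" "0 \<le> j" "j < int n"
    "face P D (j - 1) = face P C (j - 1)" "face P D (j + 1) = face P C (j + 1)"
    "face P E (j - 1) = face P C (j - 1)" "face P E (j + 1) = face P C (j + 1)"
    "face P D j \<noteq> face P C j" "face P E j \<noteq> face P C j"
  shows "face P D j = face P E j"
proof (rule diamond_three[of "face P C (j + 1)" "face P C (j - 1)" "face P C j"])
  have "(face P X (j - 1), face P X j) \<in> le_rel P" "(face P X j, face P X (j + 1)) \<in> le_rel P"
    "rk P (face P X j) = j" "rk P (face P X (j - 1)) = j - 1" "rk P (face P X (j + 1)) = j + 1"
    if "flag P X" for X
    using face_le[OF that] rk_face[OF that] assms(4,5) by auto
  from this[OF assms(1)] this[OF assms(2)] this[OF assms(3)] 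
  show "rk P (face P C (j + 1)) = rk P (face P C (j - 1)) + 2"
    "rk P (face P C j) = rk P (face P C (j - 1)) + 1"
    "rk P (face P D j) = rk P (face P C (j - 1)) + 1"
    "rk P (face P E j) = rk P (face P C (j - 1)) + 1"
    "(face P C (j - 1), face P C j) \<in> le_rel P"
    "(face P C j, face P C (j + 1)) \<in> le_rel P"
    "(face P C (j - 1), face P D j) \<in> le_rel P"
    "(face P D j, face P C (j + 1)) \<in> le_rel P"
    "(face P C (j - 1), face P E j) \<in> le_rel P"
    "(face P E j, face P C (j + 1)) \<in> le_rel P" using assms(6-9) by simp_all
qed (use assms in auto)

text \<open>The \<open>j\<close>-face is exchanged for the other face of its diamond. The result is
  still a chain because every remaining face lies at or below the face of rank \<open>j - 1\<close>,
  or at or above the face of rank \<open>j + 1\<close>.\<close>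

lemma adj_flag_exists:
  assumes "flag P C" "0 \<le> j" "j < int n"
  shows "\<exists>D. flag P D \<and> D \<noteq> C \<and> {F \<in> D. rk P F \<noteq> j} = {F \<in> C. rk P F \<noteq> j}"
proof -
  let ?F = "face P C (j - 1)" and ?G = "face P C (j + 1)" and ?A = "face P C j"
  let ?S = "{H. face_less P ?F H \<and> face_less P H ?G \<and> rk P H = rk P ?F + 1}"
  have r: "rk P ?F = j - 1" "rk P ?G = j + 1" "rk P ?A = j"
    using rk_face[OF assms(1)] assms(2,3) by auto
  have "(?F, ?G) \<in> le_rel P" using face_le[OF assms(1)] assms(2,3) by simp
  moreover have "?F \<noteq> ?G" using r by auto
  ultimately have "face_less P ?F ?G" by (simp add: face_less_def)
  moreover have "rk P ?G = rk P ?F + 2" using r by simp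
  ultimately have "card ?S = 2" using polytope unfolding polytope_def diamond_def by blast
  then obtain H where H: "H \<in> ?S" "H \<noteq> ?A" by (metis (no_types, lifting) card_2_iff')
  have le: "(?F, H) \<in> le_rel P" "(H, ?G) \<in> le_rel P" "rk P H = j"
    using H r by (auto simp: face_less_def)
  let ?D = "insert H (C - {?A})"
  have K: "(K, H) \<in> le_rel P \<or> (H, K) \<in> le_rel P" if "K \<in> C" "K \<noteq> ?A" for K
  proof -
    have e: "face P C (rk P K) = K" using face_eqI assms(1) that(1) by blast
    have b: "- 1 \<le> rk P K" "rk P K \<le> int n" using rk_bounds flag_faces assms(1) that(1) by blast+
    have "rk P K \<noteq> j" using e that by auto
    then consider "rk P K \<le> j - 1" | "rk P K \<ge> j + 1" by linarith
    then show ?thesis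
    proof cases
      case 1
      then have "(K, ?F) \<in> le_rel P" using face_le[OF assms(1), of "rk P K" "j - 1"] e b assms by simp
      then show ?thesis using le_trans le by blast
    next
      case 2
      then have "(?G, K) \<in> le_rel P" using face_le[OF assms(1), of "j + 1" "rk P K"] e b assms by simp
      then show ?thesis using le_trans le by blast
    qed
  qed
  have "?D \<in> Chains (le_rel P)"
    unfolding chain_iff using K le_refl[OF le_faces(1)[OF le(2)]] flag_chain[OF assms(1)]
    unfolding chain_iff by blast
  moreover have "{- 1..int n} \<subseteq> rk P ` ?D"
  proof
    fix i assume i: "i \<in> {- 1..int n}"
    show "i \<in> rk P ` ?D"
    proof (cases "i = j")
      case False
      then have "face P C i \<in> ?D" "rk P (face P C i) = i"
        using i face_in[OF assms(1), of i] rk_face[OF assms(1), of i] r by auto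
      then show ?thesis by (metis imageI)
    qed (use le in auto)
  qed
  ultimately have "flag P ?D" by (rule flagI)
  moreover have "?A \<notin> ?D" using H by auto
  then have "?D \<noteq> C" using face_in[OF assms(1), of j] assms by auto
  moreover have "{F \<in> ?D. rk P F \<noteq> j} = {F \<in> C. rk P F \<noteq> j}" using le r by auto
  ultimately show ?thesis by blast
qed

text \<open>Translates the set condition in \<open>adj_flag\<close> into a comparison rank by rank,
  where the diamond condition applies.\<close>

lemma agree_off_iff:
  assumes "flag P C" "flag P D"
  shows "{F \<in> D. rk P F \<noteq> j} = {F \<in> C. rk P F \<noteq> j} \<longleftrightarrow>
    (\<forall>i. - 1 \<le> i \<and> i \<le> int n \<and> i \<noteq> j \<longrightarrow> face P D i = face P C i)"
proof -
  have 1: "face P D i = face P C i"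
    if "{F \<in> D. rk P F \<noteq> j} = {F \<in> C. rk P F \<noteq> j}" "- 1 \<le> i" "i \<le> int n" "i \<noteq> j" for i
  proof -
    have "face P D i \<in> {F \<in> D. rk P F \<noteq> j}" using face_in[OF assms(2) that(2,3)] rk_face[OF assms(2) that(2,3)] that(4) by simp
    then have "face P D i \<in> {F \<in> C. rk P F \<noteq> j}" using that(1) by (rule subst[rotated])
    then have "face P D i \<in> C" by simp
    then show ?thesis using face_eqI[OF assms(1), of "face P D i" i] rk_face[OF assms(2) that(2,3)] by simp
  qed
  have 2: "{F \<in> D. rk P F \<noteq> j} \<subseteq> {F \<in> C. rk P F \<noteq> j}"
    if "\<forall>i. - 1 \<le> i \<and> i \<le> int n \<and> i \<noteq> j \<longrightarrow> face P D i = face P C i" "flag P C" "flag P D" for C D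
  proof
    fix F assume F: "F \<in> {F \<in> D. rk P F \<noteq> j}"
    have b: "- 1 \<le> rk P F" "rk P F \<le> int n" using rk_bounds flag_faces that(3) F by blast+
    have "F = face P C (rk P F)" using face_eqI[OF that(3), of F] that(1) b F by simp
    then show "F \<in> {F \<in> C. rk P F \<noteq> j}" using face_in[OF that(2) b] F by simp
  qed
  show ?thesis
  proof
    assume *: "\<forall>i. - 1 \<le> i \<and> i \<le> int n \<and> i \<noteq> j \<longrightarrow> face P D i = face P C i"
    then have "\<forall>i. - 1 \<le> i \<and> i \<le> int n \<and> i \<noteq> j \<longrightarrow> face P C i = face P D i" by metis
    from 2[OF * assms] 2[OF this assms(2,1)]
    show "{F \<in> D. rk P F \<noteq> j} = {F \<in> C. rk P F \<noteq> j}" by (rule equalityI)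
  qed (use 1 in blast)
qed

text \<open>Two flags that differ from \<open>C\<close> only at rank \<open>j\<close> have the same
  \<open>j\<close>-face by the diamond condition, so the description in \<open>adj_flag\<close> is
  definite. Adjacent flags are recognised afterwards through \<open>adj_flagI\<close>.\<close>

lemma adj_flag_props:
  assumes "flag P C" "0 \<le> j" "j < int n"
  shows flag_adj: "flag P (adj_flag P C j)"
    and face_adj_other: "- 1 \<le> i \<Longrightarrow> i \<le> int n \<Longrightarrow> i \<noteq> j \<Longrightarrow> face P (adj_flag P C j) i = face P C i"
    and face_adj_same: "face P (adj_flag P C j) j \<noteq> face P C j"
    and adj_flagI: "flag P D \<Longrightarrow> D \<noteq> C \<Longrightarrow>
      (\<And>i. - 1 \<le> i \<Longrightarrow> i \<le> int n \<Longrightarrow> i \<noteq> j \<Longrightarrow> face P D i = face P C i) \<Longrightarrow> adj_flag P C j = D"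
proof -
  let ?Q = "\<lambda>D. flag P D \<and> D \<noteq> C \<and> {F \<in> D. rk P F \<noteq> j} = {F \<in> C. rk P F \<noteq> j}"
  have Qi: "face P D i = face P C i" if "?Q D" "- 1 \<le> i" "i \<le> int n" "i \<noteq> j" for D i
    using agree_off_iff[OF assms(1), of D j] that by blast
  have Qj: "face P D j \<noteq> face P C j" if "?Q D" for D
  proof
    assume e: "face P D j = face P C j"
    have "flag P D" using that by blast
    then have "D = C" using e Qi[OF that] assms(1) by (metis flag_eqI)
    then show False using that by blast
  qed
  have uniq: "D = E" if "?Q D" "?Q E" for D E
  proof (rule flag_eqI)
    show fl: "flag P D" "flag P E" using that by blast+
    fix i assume i: "- 1 \<le> i" "i \<le> int n"
    note * = Qj[OF that(1)] Qj[OF that(2)] Qi[OF that(1)] Qi[OF that(2)]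
    show "face P D i = face P E i"
    proof (cases "i = j")
      case True
      have "face P D j = face P E j"
        by (rule face_diamond[OF assms(1) fl]) (use assms * in simp_all)
      then show ?thesis using True by simp
    qed (simp add: *(3,4) i)
  qed
  have Q: "?Q (adj_flag P C j)"
    unfolding adj_flag_def by (rule theI') (use adj_flag_exists[OF assms] uniq in blast)
  show "flag P (adj_flag P C j)" using Q by blast
  show "- 1 \<le> i \<Longrightarrow> i \<le> int n \<Longrightarrow> i \<noteq> j \<Longrightarrow> face P (adj_flag P C j) i = face P C i" using Qi[OF Q] .
  show "face P (adj_flag P C j) j \<noteq> face P C j" using Qj[OF Q] .
  assume D: "flag P D" "D \<noteq> C" "\<And>i. - 1 \<le> i \<Longrightarrow> i \<le> int n \<Longrightarrow> i \<noteq> j \<Longrightarrow> face P D i = face P C i"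
  then have "?Q D" using agree_off_iff[OF assms(1) D(1), of j] by simp
  then show "adj_flag P C j = D" using uniq[OF Q] by blast
qed

lemma adj_adj:
  assumes "flag P C" "0 \<le> j" "j < int n"
  shows "adj_flag P (adj_flag P C j) j = C"
  using adj_flagI[OF flag_adj[OF assms] assms(2,3), of C] face_adj_other[OF assms]
    face_adj_same[OF assms] assms(1) by metis

text \<open>The new \<open>j\<close>-face is determined inside a single diamond, so it depends on
  three faces of the flag only.\<close>

lemma adj_same_face:
  assumes "flag P C" "flag P D" "0 \<le> j" "j < int n"
    "\<And>i. i \<in> {j - 1, j, j + 1} \<Longrightarrow> face P C i = face P D i"
  shows "face P (adj_flag P C j) j = face P (adj_flag P D j) j"
  by (rule face_diamond[of C])
    (use assms face_adj_other[OF assms(1,3,4)] face_adj_same[OF assms(1,3,4)]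
      face_adj_other[OF assms(2-4)] face_adj_same[OF assms(2-4)]
      flag_adj[OF assms(1,3,4)] flag_adj[OF assms(2-4)] in auto)

text \<open>Exchanging a face at one of these ranks leaves the diamond at the other rank
  untouched.\<close>

lemma adj_commute:
  assumes "flag P C" "0 \<le> i" "i + 2 \<le> j" "j < int n"
  shows "adj_flag P (adj_flag P C i) j = adj_flag P (adj_flag P C j) i"
proof (rule flag_eqI)
  have i: "0 \<le> i" "i < int n" and j: "0 \<le> j" "j < int n" using assms by auto
  note fi = flag_adj[OF assms(1) i] and fj = flag_adj[OF assms(1) j]
  show "flag P (adj_flag P (adj_flag P C i) j)" "flag P (adj_flag P (adj_flag P C j) i)"
    using flag_adj fi fj i j by auto
  fix k assume k: "- 1 \<le> k" "k \<le> int n"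
  note o = face_adj_other[OF assms(1) i] face_adj_other[OF assms(1) j]
    face_adj_other[OF fi j] face_adj_other[OF fj i]
  have "face P (adj_flag P (adj_flag P C i) j) j = face P (adj_flag P C j) j"
    by (rule adj_same_face) (use fi assms j o in auto)
  moreover have "face P (adj_flag P (adj_flag P C j) i) i = face P (adj_flag P C i) i"
    by (rule adj_same_face) (use fj assms i o in auto)
  ultimately show "face P (adj_flag P (adj_flag P C i) j) k = face P (adj_flag P (adj_flag P C j) i) k"
    using o[OF k] assms(3) k by (cases "k = i"; cases "k = j") auto
qed

text \<open>Ties adjacency of sets, used in strong flag-connectedness, to adjacency at a rank. That
  rank is proper because all flags share their least and greatest faces.\<close>

lemma adjacent_adj_flag:
  assumes "flag P C" "flag P D" "adjacent C D"
  shows "\<exists>j. 0 \<le> j \<and> j < int n \<and> D = adj_flag P C j"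
proof -
  obtain F where F: "C - D = {F}" using assms(3) by (auto simp: adjacent_def card_1_singleton_iff)
  let ?j = "rk P F"
  have FC: "F \<in> C" "F \<notin> D" using F by auto
  have b: "- 1 \<le> ?j" "?j \<le> int n" using rk_bounds flag_faces assms(1) FC by blast+
  have e: "face P C ?j = F" using face_eqI assms(1) FC by blast
  have ne: "face P D ?j \<noteq> face P C ?j" using face_in[OF assms(2) b] FC e by auto
  have "?j \<noteq> - 1" "?j \<noteq> int n" using ne least_face[OF assms(1,2)] greatest_face[OF assms(1,2)] by metis+
  then have j: "0 \<le> ?j" "?j < int n" using b by auto
  have "face P D i = face P C i" if "- 1 \<le> i" "i \<le> int n" "i \<noteq> ?j" for i
  proof -
    have "face P C i \<in> C" "face P C i \<noteq> F" using face_in rk_face assms(1) that by auto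
    then have "face P C i \<in> D" using F by blast
    then show ?thesis using face_eqI[OF assms(2)] rk_face[OF assms(1)] that by blast
  qed
  then have "adj_flag P C ?j = D" using adj_flagI[OF assms(1) j assms(2)] ne by metis
  then show ?thesis using j by blast
qed

lemma adj_flag_adjacent:
  assumes "flag P C" "0 \<le> j" "j < int n"
  shows "adjacent C (adj_flag P C j)"
proof -
  have "D - C = {face P D j}" if "flag P C" "flag P D" "face P D j \<noteq> face P C j"
    "\<And>i. - 1 \<le> i \<Longrightarrow> i \<le> int n \<Longrightarrow> i \<noteq> j \<Longrightarrow> face P D i = face P C i" for C D
  proof
    have j: "- 1 \<le> j" "j \<le> int n" using assms by auto
    show "{face P D j} \<subseteq> D - C"
      using face_in[OF that(2) j] face_eqI[OF that(1)] rk_face[OF that(2) j] that(3) by auto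
    show "D - C \<subseteq> {face P D j}"
    proof
      fix F assume F: "F \<in> D - C"
      have b: "- 1 \<le> rk P F" "rk P F \<le> int n" using rk_bounds flag_faces that(2) F by blast+
      have "face P D (rk P F) = F" using face_eqI[OF that(2)] F by blast
      then have "rk P F = j" using that(4)[OF b] face_in[OF that(1) b] F by fastforce
      then show "F \<in> {face P D j}" using \<open>face P D (rk P F) = F\<close> by simp
    qed
  qed
  from this[of C "adj_flag P C j"] this[of "adj_flag P C j" C]
  show ?thesis unfolding adjacent_def
    using face_adj_same[OF assms] face_adj_other[OF assms] flag_adj[OF assms] assms(1) by auto
qed

text \<open>The size of chains is bounded, so among the chains through \<open>F\<close> there is one
  of largest size, and it is maximal.\<close>

lemma face_in_flag:
  assumes "F \<in> faces P" shows "\<exists>C. flag P C \<and> F \<in> C"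
proof -
  let ?Q = "\<lambda>C. C \<in> Chains (le_rel P) \<and> F \<in> C"
  have "?Q {F}" using le_refl[OF assms] by (simp add: chain_iff)
  moreover have "\<forall>C. ?Q C \<longrightarrow> card C < n + 3" using chain_card by fastforce
  ultimately obtain C where C: "?Q C" "\<forall>D. ?Q D \<longrightarrow> card D \<le> card C"
    using ex_has_greatest_nat[of ?Q "{F}" card "n + 3"] by blast
  have "flag P C" unfolding flag_def
  proof (intro conjI ballI impI)
    fix D assume D: "D \<in> Chains (le_rel P)" "C \<subseteq> D"
    then have "card D \<le> card C" using C by blast
    then show "D = C" using card_seteq[OF chain_finite[OF D(1)] D(2)] by blast
  qed (use C in blast)
  then show ?thesis using C by blast
qed

text \<open>Strong flag-connectedness as an induction rule. Each step retains the inclusion of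
  \<open>C \<inter> E\<close>, on which the path argument in the coset poset depends.\<close>

lemma flags_induct:
  assumes "flag P C" "flag P E" "Q C"
    and step: "\<And>D j. flag P D \<Longrightarrow> Q D \<Longrightarrow> 0 \<le> j \<Longrightarrow> j < int n \<Longrightarrow>
      C \<inter> E \<subseteq> adj_flag P D j \<Longrightarrow> Q (adj_flag P D j)"
  shows "Q E"
proof -
  have "(\<lambda>A D. flag P D \<and> adjacent A D \<and> C \<inter> E \<subseteq> D)\<^sup>*\<^sup>* C E"
    using polytope assms(1,2) by (simp add: polytope_def strongly_flag_connected_def)
  then have "flag P E \<and> Q E"
  proof (induction rule: rtranclp_induct)
    case (step A D)
    then obtain j where "0 \<le> j" "j < int n" "D = adj_flag P A j"
      using adjacent_adj_flag[of A D] by blast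
    then show ?case using step assms(4)[of A j] by blast
  qed (use assms in auto)
  then show ?thesis by simp
qed

end

section \<open>Automorphisms\<close>

lemma aut_iff: "f \<in> carrier (aut_group P) \<longleftrightarrow> f \<in> Bij (faces P) \<and>
    (\<forall>F \<in> faces P. \<forall>G \<in> faces P. (f F, f G) \<in> le_rel P \<longleftrightarrow> (F, G) \<in> le_rel P)"
  by (simp add: aut_group_def)

lemma aut_Bij: "f \<in> carrier (aut_group P) \<Longrightarrow> f \<in> Bij (faces P)"
  by (simp add: aut_iff)

lemma aut_le: "f \<in> carrier (aut_group P) \<Longrightarrow> F \<in> faces P \<Longrightarrow> G \<in> faces P \<Longrightarrow>
    (f F, f G) \<in> le_rel P \<longleftrightarrow> (F, G) \<in> le_rel P"
  by (simp add: aut_iff)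

lemma aut_faces: "f \<in> carrier (aut_group P) \<Longrightarrow> F \<in> faces P \<Longrightarrow> f F \<in> faces P"
  using aut_Bij Bij_imp_funcset by blast

lemma aut_inj: "f \<in> carrier (aut_group P) \<Longrightarrow> inj_on f (faces P)"
  using aut_Bij by (auto simp: Bij_def bij_betw_def)

lemma aut_mult: "F \<in> faces P \<Longrightarrow> (f \<otimes>\<^bsub>aut_group P\<^esub> g) F = g (f F)"
  by (simp add: aut_group_def compose_def)

lemma aut_one: "F \<in> faces P \<Longrightarrow> \<one>\<^bsub>aut_group P\<^esub> F = F"
  by (simp add: aut_group_def)

lemma aut_ext:
  "f \<in> carrier (aut_group P) \<Longrightarrow> g \<in> carrier (aut_group P) \<Longrightarrow> (\<And>F. F \<in> faces P \<Longrightarrow> f F = g F) \<Longrightarrow> f = g"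
  by (rule extensionalityI[of f "faces P"]) (auto dest: aut_Bij Bij_imp_extensional)

lemma aut_group_is_group: "group (aut_group P)"
proof (rule groupI)
  let ?A = "aut_group P"
  show m: "f \<otimes>\<^bsub>?A\<^esub> g \<in> carrier ?A" if "f \<in> carrier ?A" "g \<in> carrier ?A" for f g
  proof -
    have "f \<otimes>\<^bsub>?A\<^esub> g \<in> Bij (faces P)"
      using compose_Bij[OF aut_Bij[OF that(2)] aut_Bij[OF that(1)]] by (simp add: aut_group_def)
    then show ?thesis using that by (simp add: aut_iff[of "f \<otimes>\<^bsub>?A\<^esub> g"] aut_mult aut_le aut_faces)
  qed
  show o: "\<one>\<^bsub>?A\<^esub> \<in> carrier ?A"
    using id_Bij[of "faces P"] by (simp add: aut_group_def)
  show "f \<otimes>\<^bsub>?A\<^esub> g \<otimes>\<^bsub>?A\<^esub> h = f \<otimes>\<^bsub>?A\<^esub> (g \<otimes>\<^bsub>?A\<^esub> h)"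
    if "f \<in> carrier ?A" "g \<in> carrier ?A" "h \<in> carrier ?A" for f g h
    by (rule aut_ext[of _ P]) (simp_all add: m that aut_mult aut_faces)
  show "\<one>\<^bsub>?A\<^esub> \<otimes>\<^bsub>?A\<^esub> f = f" if "f \<in> carrier ?A" for f
    by (rule aut_ext[of _ P]) (simp_all add: m o that aut_mult aut_one)
  show "\<exists>g\<in>carrier ?A. g \<otimes>\<^bsub>?A\<^esub> f = \<one>\<^bsub>?A\<^esub>" if f: "f \<in> carrier ?A" for f
  proof
    let ?g = "\<lambda>x\<in>faces P. inv_into (faces P) f x"
    have im: "f ` faces P = faces P" using aut_Bij[OF f] by (auto simp: Bij_def bij_betw_def)
    have gB: "?g \<in> Bij (faces P)" by (rule restrict_inv_into_Bij[OF aut_Bij[OF f]])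
    have fg: "f (?g F) = F" "?g F \<in> faces P" if "F \<in> faces P" for F
      using that im f_inv_into_f[of F f] inv_into_into[of F f] by auto
    show g: "?g \<in> carrier ?A"
      unfolding aut_iff
    proof (intro conjI ballI gB)
      fix F G assume "F \<in> faces P" "G \<in> faces P"
      then show "(?g F, ?g G) \<in> le_rel P \<longleftrightarrow> (F, G) \<in> le_rel P"
        using aut_le[OF f fg(2) fg(2), of F G] fg(1) by simp
    qed
    show "?g \<otimes>\<^bsub>?A\<^esub> f = \<one>\<^bsub>?A\<^esub>"
      by (rule aut_ext[of _ P]) (use m g f o fg in \<open>simp_all add: aut_mult aut_one\<close>)
  qed
qed

section \<open>The action of automorphisms on flags\<close>

context abstract_polytope
begin

abbreviation A where "A \<equiv> aut_group P"

lemma aut_mult_image: "flag P C \<Longrightarrow> (f \<otimes>\<^bsub>A\<^esub> g) ` C = g ` f ` C"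
  using flag_faces by (force simp: aut_mult image_iff)

lemma aut_one_image: "flag P C \<Longrightarrow> \<one>\<^bsub>A\<^esub> ` C = C"
  using flag_faces by (force simp: aut_one image_iff)

text \<open>An automorphism keeps the number of faces in a chain, and a chain with
  \<open>n + 2\<close> faces is maximal.\<close>

lemma flag_image:
  assumes f: "f \<in> carrier A" and C: "flag P C" shows "flag P (f ` C)"
  unfolding flag_def
proof (intro conjI ballI impI)
  have "(f F, f G) \<in> le_rel P \<or> (f G, f F) \<in> le_rel P" if "F \<in> C" "G \<in> C" for F G
    using flag_chain[OF C] that aut_le[OF f] flag_faces[OF C] unfolding chain_iff by blast
  then show "f ` C \<in> Chains (le_rel P)" unfolding chain_iff by blast
  fix D assume D: "D \<in> Chains (le_rel P)" "f ` C \<subseteq> D"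
  have "inj_on f C" using aut_inj[OF f] chain_faces[OF flag_chain[OF C]] by (rule inj_on_subset)
  then have "card (f ` C) = n + 2" using card_image[of f C] polytope C by (simp add: polytope_def)
  then show "D = f ` C" using card_seteq[OF chain_finite[OF D(1)] D(2)] chain_card[OF D(1)] by simp
qed

text \<open>Describes the rank through the order alone, which is all that an element of
  \<open>aut_group\<close> is required to preserve.\<close>

lemma rk_card:
  assumes "flag P C" "F \<in> C" shows "int (card {G \<in> C. (G, F) \<in> le_rel P}) = rk P F + 2"
proof -
  have b: "- 1 \<le> rk P F" "rk P F \<le> int n" using rk_bounds flag_faces assms by blast+
  have e: "face P C (rk P F) = F" using face_eqI assms by blast
  have "rk P ` {G \<in> C. (G, F) \<in> le_rel P} = {- 1..rk P F}"
  proof (intro equalityI subsetI)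
    fix i assume "i \<in> rk P ` {G \<in> C. (G, F) \<in> le_rel P}"
    then show "i \<in> {- 1..rk P F}" using rk_mono rk_bounds flag_faces[OF assms(1)] by auto
  next
    fix i assume "i \<in> {- 1..rk P F}"
    then have i: "- 1 \<le> i" "i \<le> rk P F" "i \<le> int n" using b by auto
    then have "face P C i \<in> {G \<in> C. (G, F) \<in> le_rel P}" "rk P (face P C i) = i"
      using face_le[OF assms(1), of i "rk P F"] face_in[OF assms(1)] rk_face[OF assms(1)] b e by auto
    then show "i \<in> rk P ` {G \<in> C. (G, F) \<in> le_rel P}" by (metis imageI)
  qed
  moreover have "inj_on (rk P) {G \<in> C. (G, F) \<in> le_rel P}"
    using chain_rk_inj[OF flag_chain[OF assms(1)]] by (rule inj_on_subset) blast
  ultimately show ?thesis using card_image[of "rk P" "{G \<in> C. (G, F) \<in> le_rel P}"] b by simp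
qed

lemma rk_aut:
  assumes f: "f \<in> carrier A" and F: "F \<in> faces P" shows "rk P (f F) = rk P F"
proof -
  obtain C where C: "flag P C" "F \<in> C" using face_in_flag[OF F] by blast
  have "{G \<in> f ` C. (G, f F) \<in> le_rel P} = f ` {G \<in> C. (G, F) \<in> le_rel P}"
    using aut_le[OF f _ F] flag_faces[OF C(1)] by auto
  moreover have "inj_on f {G \<in> C. (G, F) \<in> le_rel P}"
    using aut_inj[OF f] by (rule inj_on_subset) (use flag_faces[OF C(1)] in blast)
  ultimately have "card {G \<in> f ` C. (G, f F) \<in> le_rel P} = card {G \<in> C. (G, F) \<in> le_rel P}"
    by (simp only: card_image)
  then show ?thesis using rk_card[OF C] rk_card[OF flag_image[OF f C(1)], of "f F"] C(2) by simp
qed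

lemma face_image:
  assumes "f \<in> carrier A" "flag P C" "- 1 \<le> j" "j \<le> int n"
  shows "face P (f ` C) j = f (face P C j)"
  by (rule face_eqI)
    (use assms flag_image face_in rk_face rk_aut flag_faces in auto)

lemma adj_image:
  assumes f: "f \<in> carrier A" and C: "flag P C" and j: "0 \<le> j" "j < int n"
  shows "f ` adj_flag P C j = adj_flag P (f ` C) j"
proof (rule sym, rule adj_flagI[OF flag_image[OF f C] j])
  note a = flag_adj[OF C j]
  show "flag P (f ` adj_flag P C j)" by (rule flag_image[OF f a])
  show "face P (f ` adj_flag P C j) i = face P (f ` C) i" if "- 1 \<le> i" "i \<le> int n" "i \<noteq> j" for i
    using face_image[OF f a that(1,2)] face_image[OF f C that(1,2)] face_adj_other[OF C j that] by simp
  have "face P C j \<in> faces P" "face P (adj_flag P C j) j \<in> faces P"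
    using flag_faces face_in C a j by auto
  then have "f (face P (adj_flag P C j) j) \<noteq> f (face P C j)"
    using aut_inj[OF f] face_adj_same[OF C j] by (auto dest: inj_onD)
  then show "f ` adj_flag P C j \<noteq> f ` C"
    using face_image[OF f a, of j] face_image[OF f C, of j] j by auto
qed

text \<open>Automorphisms act freely on flags: agreement on one flag passes to adjacent flags, hence
  along a path to a flag through any given face.\<close>

lemma aut_eqI:
  assumes f: "f \<in> carrier A" and g: "g \<in> carrier A" and C: "flag P C" and eq: "f ` C = g ` C"
  shows "f = g"
proof (rule aut_ext[OF f g])
  fix F assume "F \<in> faces P"
  then obtain E where E: "flag P E" "F \<in> E" using face_in_flag by blast
  have "f ` E = g ` E"
    by (rule flags_induct[OF C E(1), of "\<lambda>D. f ` D = g ` D"])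
      (use eq adj_image[OF f] adj_image[OF g] in auto)
  have b: "- 1 \<le> rk P F" "rk P F \<le> int n" using rk_bounds \<open>F \<in> faces P\<close> by blast+
  have e: "face P E (rk P F) = F" using face_eqI E by blast
  then show "f F = g F" using face_image[OF f E(1) b] face_image[OF g E(1) b] \<open>f ` E = g ` E\<close> by simp
qed

lemma aut_toI:
  assumes "f \<in> carrier A" "flag P C" "f ` C = D"
  shows "aut_to P C D = f"
  unfolding aut_to_def by (rule the_equality) (use assms aut_eqI in auto)

end

section \<open>Duality and rotations\<close>

lemma faces_dual: "faces (dual n P) = faces P"
  by (simp add: faces_def dual_def)

lemma aut_group_dual: "aut_group (dual n P) = aut_group P"
  unfolding aut_group_def faces_dual by (auto simp: dual_def)

lemma Chains_converse: "Chains (r\<inverse>) = Chains r"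
  by (auto simp: Chains_def)

lemma flag_dual: "flag (dual n P) = flag P"
  by (simp add: flag_def dual_def Chains_converse fun_eq_iff)

lemma regular_dual: "regular (dual n P) \<longleftrightarrow> regular P"
  by (simp add: regular_def flag_orbit_def aut_group_dual flag_dual)

lemma adj_flag_dual: "adj_flag (dual n P) C j = adj_flag P C (int n - 1 - j)"
proof -
  have "rk (dual n P) F \<noteq> j \<longleftrightarrow> rk P F \<noteq> int n - 1 - j" for F
    by (auto simp: dual_def)
  then show ?thesis by (simp only: adj_flag_def flag_dual)
qed

lemma aut_to_dual: "aut_to (dual n P) = aut_to P"
  by (simp add: aut_to_def aut_group_dual fun_eq_iff)

text \<open>The automorphism taking \<open>C\<close> to \<open>(C\<^sup>i)\<^sup>j\<close>; the generators of both \<open>P\<close> and its dual have this form.\<close>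

definition turn :: "'f ranked_poset \<Rightarrow> 'f set \<Rightarrow> int \<Rightarrow> int \<Rightarrow> 'f \<Rightarrow> 'f" where
  "turn P C i j =
     (if regular P then rho P C j \<otimes>\<^bsub>aut_group P\<^esub> rho P C i
      else aut_to P C (adj_flag P (adj_flag P C i) j))"

lemma sigma_turn: "sigma P C i = turn P C (int i) (int i - 1)"
  by (simp add: sigma_def turn_def)

text \<open>Rank \<open>i\<close> of the dual is rank \<open>n - 1 - i\<close> of \<open>P\<close>,
  so the dual ranks \<open>i\<close> and \<open>i - 1\<close> become \<open>n - 1 - i\<close> and
  \<open>n - i\<close>.\<close>

lemma sigma_dual_turn: "sigma (dual n P) C i = turn P C (int n - 1 - int i) (int n - int i)"
  by (simp add: sigma_def turn_def rho_def regular_dual aut_group_dual aut_to_dual adj_flag_dual)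

section \<open>Rotations and their effect on faces\<close>

context abstract_polytope
begin

sublocale A: group A
  by (rule aut_group_is_group)

text \<open>In the regular case the reflections exist and are multiplied. In the chiral case the
  intermediate flag lies in the other of the two orbits, both from \<open>C\<close> and from the
  target, so these two share an orbit.\<close>

lemma turn_props:
  assumes C: "flag P C" and sym: "chiral P \<or> regular P"
    and i: "0 \<le> i" "i < int n" and j: "0 \<le> j" "j < int n"
  shows turn_closed: "turn P C i j \<in> carrier A"
    and turn_image: "turn P C i j ` C = adj_flag P (adj_flag P C i) j"
proof -
  note ai = flag_adj[OF C i] and aj = flag_adj[OF C j]
  have "turn P C i j \<in> carrier A \<and> turn P C i j ` C = adj_flag P (adj_flag P C i) j"
  proof (cases "regular P")
    case True
    have r: "rho P C k \<in> carrier A" "rho P C k ` C = adj_flag P C k" if k: "0 \<le> k" "k < int n" for k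
    proof -
      have "adj_flag P C k \<in> flag_orbit P C"
        using True flag_adj[OF C k] C by (simp add: regular_def)
      then obtain f where f: "f \<in> carrier A" "f ` C = adj_flag P C k" by (auto simp: flag_orbit_def)
      then have "rho P C k = f" unfolding rho_def by (rule aut_toI[OF _ C])
      then show "rho P C k \<in> carrier A" "rho P C k ` C = adj_flag P C k" using f by simp_all
    qed
    \<comment> \<open>Products act from left to right: \<open>rho P C j\<close> sends
      \<open>C\<close> to its \<open>j\<close>-adjacent flag, and \<open>rho P C i\<close> then
      commutes with passing to \<open>j\<close>-adjacent flags.\<close>
    show ?thesis
      using True aut_mult_image[OF C] r[OF i] r[OF j] adj_image[OF r(1)[OF i] C j]
      by (simp add: turn_def)
  next
    case False
    let ?E = "adj_flag P (adj_flag P C i) j"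
    have E: "flag P ?E" by (rule flag_adj[OF ai j])
    have ch: "card (flag_orbit P ` {C. flag P C}) = 2"
      "\<And>C D. flag P C \<Longrightarrow> flag P D \<Longrightarrow> adjacent C D \<Longrightarrow> flag_orbit P C \<noteq> flag_orbit P D"
      using sym False by (auto simp: chiral_def)
    have "flag_orbit P C \<noteq> flag_orbit P (adj_flag P C i)"
      "flag_orbit P ?E \<noteq> flag_orbit P (adj_flag P C i)"
      using ch(2)[OF C ai adj_flag_adjacent[OF C i]] ch(2)[OF ai E adj_flag_adjacent[OF ai j]] by auto
    moreover obtain x y where xy: "flag_orbit P ` {C. flag P C} = {x, y}"
      using ch(1) by (auto simp: card_2_iff)
    have "flag_orbit P D \<in> {x, y}" if "flag P D" for D using that xy by blast
    from this[OF C] this[OF ai] this[OF E] have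
      "flag_orbit P C = x \<or> flag_orbit P C = y"
      "flag_orbit P (adj_flag P C i) = x \<or> flag_orbit P (adj_flag P C i) = y"
      "flag_orbit P ?E = x \<or> flag_orbit P ?E = y" by simp_all
    ultimately have "flag_orbit P C = flag_orbit P ?E" by metis
    moreover have "?E \<in> flag_orbit P ?E"
      unfolding flag_orbit_def using aut_one_image[OF E] A.one_closed by (metis imageI)
    ultimately have "?E \<in> flag_orbit P C" by simp
    then obtain f where f: "f \<in> carrier A" "f ` C = ?E" by (auto simp: flag_orbit_def)
    then have "turn P C i j = f" using False aut_toI[OF f(1) C f(2)] by (simp add: turn_def)
    then show ?thesis using f by simp
  qed
  then show "turn P C i j \<in> carrier A" "turn P C i j ` C = adj_flag P (adj_flag P C i) j" by auto
qed

text \<open>The product telescopes: each new left factor cancels the change at rank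
  \<open>a i\<close> and makes one at rank \<open>a (i - 1)\<close>. The sequence \<open>a\<close>
  will be the identity for \<open>P\<close> and the reversal of ranks for its dual.\<close>

lemma tau_image:
  assumes C: "flag P C" and s: "\<And>k. k \<in> {i..j} \<Longrightarrow> s k \<in> carrier A"
      "\<And>k. k \<in> {i..j} \<Longrightarrow> s k ` C = adj_flag P (adj_flag P C (a k)) (a (k - 1))"
    and a: "\<And>k. i \<le> Suc k \<Longrightarrow> k \<le> j \<Longrightarrow> 0 \<le> a k \<and> a k < int n"
    and ij: "1 \<le> i" "i \<le> j"
  shows "tau A s i j \<in> carrier A \<and> tau A s i j ` C = adj_flag P (adj_flag P C (a j)) (a (i - 1))"
  using ij(2,1) s a
proof (induction i rule: inc_induct)
  case base
  then have "s j \<in> carrier A" "s j ` C = adj_flag P (adj_flag P C (a j)) (a (j - 1))" by simp_all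
  then show ?case by (simp add: tau_def)
next
  case (step i)
  let ?t = "tau A s (Suc i) j"
  have t: "?t \<in> carrier A" "?t ` C = adj_flag P (adj_flag P C (a j)) (a i)"
    using step.IH step.prems by auto
  have si: "s i \<in> carrier A" "s i ` C = adj_flag P (adj_flag P C (a i)) (a (i - 1))"
    using step by auto
  have r: "0 \<le> a i" "a i < int n" "0 \<le> a (i - 1)" "a (i - 1) < int n" "0 \<le> a j" "a j < int n"
    using step.prems(4)[of i] step.prems(4)[of "i - 1"] step.prems(4)[of j] step.hyps step.prems(1) by auto
  have e: "tau A s i j = s i \<otimes>\<^bsub>A\<^esub> ?t" using step.hyps by (simp add: tau_def upt_rec)
  have "tau A s i j ` C = ?t ` s i ` C" using aut_mult_image[OF C] e by simp
  also have "\<dots> = adj_flag P (adj_flag P (?t ` C) (a i)) (a (i - 1))"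
    using adj_image[OF t(1) flag_adj[OF C r(1,2)] r(3,4)] adj_image[OF t(1) C r(1,2)] si(2) by simp
  also have "\<dots> = adj_flag P (adj_flag P C (a j)) (a (i - 1))"
    using t(2) adj_adj[OF flag_adj[OF C r(5,6)] r(1,2)] by simp
  finally show ?case using e t(1) si(1) by simp
qed

lemma stabilizer_subgroup: "F \<in> faces P \<Longrightarrow> subgroup {f \<in> carrier A. f F = F} A"
proof (rule A.subgroupI)
  fix f assume F: "F \<in> faces P" and f: "f \<in> {f \<in> carrier A. f F = F}"
  then have "(f \<otimes>\<^bsub>A\<^esub> inv\<^bsub>A\<^esub> f) F = (inv\<^bsub>A\<^esub> f) F"
    using aut_mult[OF F, of f "inv\<^bsub>A\<^esub> f"] by (simp del: A.r_inv)
  then show "inv\<^bsub>A\<^esub> f \<in> {f \<in> carrier A. f F = F}" using f F by (simp add: aut_one)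
qed (auto simp: aut_mult aut_one)

text \<open>The flag changes at two ranks only; this places the generators of a face subgroup in the
  stabilizer of a face.\<close>

lemma tau_fixes_face:
  assumes C: "flag P C" and s: "\<And>k. k \<in> {i..j} \<Longrightarrow> s k \<in> carrier A"
      "\<And>k. k \<in> {i..j} \<Longrightarrow> s k ` C = adj_flag P (adj_flag P C (a k)) (a (k - 1))"
    and a: "\<And>k. i \<le> Suc k \<Longrightarrow> k \<le> j \<Longrightarrow> 0 \<le> a k \<and> a k < int n"
    and ij: "1 \<le> i" "i \<le> j"
    and r: "- 1 \<le> r" "r \<le> int n" "r \<noteq> a j" "r \<noteq> a (i - 1)"
  shows "tau A s i j (face P C r) = face P C r"
proof -
  have t: "tau A s i j \<in> carrier A" "tau A s i j ` C = adj_flag P (adj_flag P C (a j)) (a (i - 1))"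
    using tau_image[where a = a and s = s, OF C s a ij] by auto
  have b: "0 \<le> a j" "a j < int n" "0 \<le> a (i - 1)" "a (i - 1) < int n"
    using a[of j] a[of "i - 1"] ij by auto
  have "tau A s i j (face P C r) = face P (tau A s i j ` C) r"
    using face_image[OF t(1) C r(1,2)] by simp
  also have "\<dots> = face P C r"
    using t(2) face_adj_other[OF C b(1,2) r(1-3)]
      face_adj_other[OF flag_adj[OF C b(1,2)] b(3,4) r(1,2,4)] by simp
  finally show ?thesis .
qed

text \<open>Every automorphism fixes the two improper faces, so checking the proper ranks
  suffices.\<close>

lemma aut_fixes_flagI:
  assumes f: "f \<in> carrier A" and C: "flag P C"
    and "\<And>j. 0 \<le> j \<Longrightarrow> j < int n \<Longrightarrow> f (face P C j) = face P C j"
  shows "f = \<one>\<^bsub>A\<^esub>"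
proof (rule aut_eqI[OF f A.one_closed C])
  have "f ` C = C"
  proof (rule flag_eqI[OF flag_image[OF f C] C])
    fix j assume j: "- 1 \<le> j" "j \<le> int n"
    then consider "j = -1" | "j = int n" | "0 \<le> j" "j < int n" by linarith
    then show "face P (f ` C) j = face P C j"
      by cases (use least_face[OF flag_image[OF f C] C] greatest_face[OF flag_image[OF f C] C]
        face_image[OF f C j] assms(3) in auto)
  qed
  then show "f ` C = \<one>\<^bsub>A\<^esub> ` C" using aut_one_image[OF C] by simp
qed

end

section \<open>The mix inside the product of the automorphism groups\<close>

lemma rot_group_eq: "\<exists>S. subgroup S (aut_group P) \<and> rot_group n P C = (aut_group P)\<lparr>carrier := S\<rparr> \<and>
    sigma P C ` {1..n - 1} \<subseteq> S"
  if s: "sigma P C ` {1..n - 1} \<subseteq> carrier (aut_group P)"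
proof -
  interpret group "aut_group P" by (rule aut_group_is_group)
  show ?thesis
  proof (cases "regular P")
    case True
    let ?S = "generate (aut_group P) (sigma P C ` {1..n - 1})"
    have "sigma P C ` {1..n - 1} \<subseteq> ?S" by (meson generate.incl subsetI)
    then show ?thesis using True generate_is_subgroup[OF s]
      by (intro exI[of _ ?S]) (simp add: rot_group_def)
  next
    case False
    then show ?thesis using subgroup_self s by (intro exI[of _ "carrier (aut_group P)"]) (simp add: rot_group_def)
  qed
qed

text \<open>The rotation groups are subgroups containing their specified generators, so generating
  inside their product or inside the full product gives the same group. This removes the distinction
  between regular and chiral.\<close>

lemma mix_group_eq:
  assumes s: "sigma P C ` {1..n - 1} \<subseteq> carrier (aut_group P)"
    and t: "sigma Q D ` {1..n - 1} \<subseteq> carrier (aut_group Q)"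
  defines "B \<equiv> aut_group P \<times>\<times> aut_group Q"
  shows "mix_group n P C Q D = B\<lparr>carrier := generate B (mix_gen P C Q D ` {1..n - 1})\<rparr>"
proof -
  obtain S where S: "subgroup S (aut_group P)" "rot_group n P C = (aut_group P)\<lparr>carrier := S\<rparr>"
    "sigma P C ` {1..n - 1} \<subseteq> S" using rot_group_eq[OF s] by blast
  obtain T where T: "subgroup T (aut_group Q)" "rot_group n Q D = (aut_group Q)\<lparr>carrier := T\<rparr>"
    "sigma Q D ` {1..n - 1} \<subseteq> T" using rot_group_eq[OF t] by blast
  interpret B: group B unfolding B_def by (intro DirProd_group aut_group_is_group)
  have "subgroup (S \<times> T) B" unfolding B_def
    by (rule DirProd_subgroups[OF aut_group_is_group S(1) aut_group_is_group T(1)])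
  moreover have "mix_gen P C Q D ` {1..n - 1} \<subseteq> S \<times> T"
    using S(3) T(3) by (auto simp: mix_gen_def)
  moreover have "rot_group n P C \<times>\<times> rot_group n Q D = B\<lparr>carrier := S \<times> T\<rparr>"
    by (simp add: S(2) T(2) B_def DirProd_def)
  ultimately show ?thesis by (simp add: mix_group_def B.generate_consistent)
qed

section \<open>Paths of flags in the coset poset\<close>

definition face_stab :: "nat \<Rightarrow> ('g, 'b) monoid_scheme \<Rightarrow> (nat \<Rightarrow> 'g) \<Rightarrow> int \<Rightarrow> 'g set" where
  "face_stab n G s k = sub_gen n G s ({0..int n - 1} - {k})"

lemma (in group) tau_closed:
  assumes "\<And>k. i \<le> k \<Longrightarrow> k \<le> j \<Longrightarrow> s k \<in> carrier G"
  shows "tau G s i j \<in> carrier G"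
proof -
  have "foldr (\<lambda>k x. s k \<otimes> x) ks \<one> \<in> carrier G" if "\<forall>k\<in>set ks. s k \<in> carrier G" for ks
    using that by (induction ks) auto
  moreover have "\<forall>k\<in>set [i..<Suc j]. s k \<in> carrier G" using assms by auto
  ultimately show ?thesis unfolding tau_def by blast
qed

locale generated_group = group G for G (structure) +
  fixes n :: nat and s :: "nat \<Rightarrow> 'a"
  assumes gen_closed: "\<And>i. 1 \<le> i \<Longrightarrow> i \<le> n - 1 \<Longrightarrow> s i \<in> carrier G"
begin

abbreviation H where "H \<equiv> face_stab n G s"

lemma H_subgroup: "subgroup (H k) G"
  unfolding face_stab_def sub_gen_def
  by (rule generate_is_subgroup) (use gen_closed in \<open>auto intro!: tau_closed\<close>)

lemma tau_in_H:
  assumes "1 \<le> i" "i \<le> j" "j \<le> n - 1" "int i - 1 \<noteq> k" "int j \<noteq> k"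
  shows "tau G s i j \<in> H k"
  unfolding face_stab_def sub_gen_def by (rule generate.incl) (use assms in force)

lemma gen_in_H:
  assumes "1 \<le> i" "i \<le> n - 1" "int i - 1 \<noteq> k" "int i \<noteq> k"
  shows "s i \<in> H k"
  using tau_in_H[of i i k] assms gen_closed by (simp add: tau_def)

text \<open>The labels of this product are \<open>i - 1\<close> and \<open>i + 1\<close>, so it
  avoids rank \<open>i\<close> although both factors involve it.\<close>

lemma gen_pair_in_H:
  assumes "1 \<le> i" "i + 1 \<le> n - 1"
  shows "s i \<otimes> s (i + 1) \<in> H (int i)"
  using tau_in_H[of i "i + 1" "int i"] assms gen_closed[of "i + 1"] by (simp add: tau_def)

lemma H_coset_eq_iff:
  assumes "x \<in> carrier G" "y \<in> carrier G"
  shows "H k #> x = H k #> y \<longleftrightarrow> x \<otimes> inv y \<in> H k"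
proof
  assume "H k #> x = H k #> y"
  then have "x \<in> H k #> y" using rcos_self[OF assms(1) H_subgroup] by metis
  then obtain h where "h \<in> H k" "x = h \<otimes> y" by (auto simp: r_coset_def)
  then show "x \<otimes> inv y \<in> H k"
    using assms(2) subgroup.mem_carrier[OF H_subgroup, of h k] by (simp add: m_assoc)
next
  assume "x \<otimes> inv y \<in> H k"
  moreover have "x = (x \<otimes> inv y) \<otimes> y" using assms by (simp add: m_assoc)
  ultimately have "x \<in> H k #> y" unfolding r_coset_def by blast
  then show "H k #> x = H k #> y" using repr_independence assms(2) H_subgroup by metis
qed

abbreviation Q where "Q \<equiv> coset_poset n G s"

lemma coset_le_iff: "((i, U), (j, V)) \<in> le_rel Q \<longleftrightarrow>
    (i, U) \<in> coset_faces n G s \<and> (j, V) \<in> coset_faces n G s \<and> i \<le> j \<and> U \<inter> V \<noteq> {}"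
  by (simp add: coset_poset_def)

lemma coset_face: "- 1 \<le> i \<Longrightarrow> i \<le> int n \<Longrightarrow> x \<in> carrier G \<Longrightarrow> (i, H i #> x) \<in> coset_faces n G s"
  using rcosetsI[OF subgroup.subset[OF H_subgroup[of i]]]
  by (simp add: coset_faces_def face_stab_def)

text \<open>Incidence is nonempty intersection, and \<open>z\<close> serves as a common element of
  the two cosets.\<close>

lemma coset_leI:
  assumes "- 1 \<le> i" "i \<le> j" "j \<le> int n" "x \<in> carrier G" "y \<in> carrier G"
    "z \<in> carrier G" "z \<otimes> inv x \<in> H i" "z \<otimes> inv y \<in> H j"
  shows "((i, H i #> x), (j, H j #> y)) \<in> le_rel Q"
proof -
  have "z \<in> H i #> x" "z \<in> H j #> y"
    using H_coset_eq_iff[of z x i] H_coset_eq_iff[of z y j] rcos_self[OF _ H_subgroup, of z] assms by auto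
  then show ?thesis using assms coset_face by (auto simp: coset_le_iff)
qed

end

locale coset_polytope = generated_group +
  assumes coset_polytope: "polytope n (coset_poset n G s)"
begin

sublocale Q: abstract_polytope n Q
  by unfold_locales (rule coset_polytope)

text \<open>The translate by \<open>x\<close> of the base flag, whose faces are the subgroups
  \<open>H i\<close>.\<close>

definition coset_flag where "coset_flag x = (\<lambda>i. (i, H i #> x)) ` {- 1..int n}"

lemma coset_flag:
  assumes "x \<in> carrier G" shows "flag Q (coset_flag x)"
proof (rule Q.flagI)
  have le: "((i, H i #> x), (j, H j #> x)) \<in> le_rel Q" if "- 1 \<le> i" "i \<le> j" "j \<le> int n" for i j
    by (rule coset_leI[of _ _ _ _ x]) (use that assms subgroup.one_closed[OF H_subgroup] in auto)
  then show "coset_flag x \<in> Chains (le_rel Q)"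
    unfolding chain_iff coset_flag_def by (auto simp del: split_paired_All) (meson le linear)
  show "{- 1..int n} \<subseteq> rk Q ` coset_flag x"
    by (force simp: coset_flag_def coset_poset_def)
qed

lemma rk_Q: "rk Q (i, U) = i"
  by (simp add: coset_poset_def)

lemma face_coset_flag:
  assumes "x \<in> carrier G" "- 1 \<le> i" "i \<le> int n"
  shows "face Q (coset_flag x) i = (i, H i #> x)"
  by (rule Q.face_eqI) (use assms coset_flag rk_Q in \<open>auto simp: coset_flag_def\<close>)

end

text \<open>The invariant \<open>p\<close> of the path says that a flag is, in ranks \<open>m - 1\<close> and \<open>m\<close>, the translate by
  some power of \<open>s\<^sub>m\<close> of the base flag or of its \<open>m\<close>-adjacent flag, whose \<open>m\<close>-face is \<open>H\<^sub>m s\<^sub>m\<close>.\<close>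

lemma (in coset_polytope) coset_flag_path:
  assumes m: "2 \<le> m" "m + 1 \<le> n"
    and x: "x \<in> carrier G" "\<And>k. k \<noteq> int m - 1 \<Longrightarrow> k \<noteq> int m \<Longrightarrow> x \<in> H k"
    and nin: "s m \<notin> H (int m - 1)" "s m \<notin> H (int m)"
  shows "\<exists>g \<in> generate G {s m}. x \<otimes> inv g \<in> H (int m - 1) \<and>
    (x \<otimes> inv g \<in> H (int m) \<or> x \<otimes> inv (s m \<otimes> g) \<in> H (int m))"
proof -
  let ?i = "int m - 1" and ?j = "int m"
  let ?Z = "generate G {s m}"
  have sm: "s m \<in> carrier G" and sm': "s (m - 1) \<in> carrier G" using gen_closed m by auto
  have Z: "subgroup ?Z G" by (rule generate_is_subgroup) (use sm in auto)
  interpret Z: subgroup ?Z G by (rule Z)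
  have smZ: "s m \<in> ?Z" by (rule generate.incl) simp
  have ZH: "g \<in> H k" if "k \<noteq> ?i" "k \<noteq> ?j" "g \<in> ?Z" for g k
  proof -
    have "s m \<in> H k" by (rule gen_in_H) (use m that in auto)
    then have "?Z \<subseteq> H k" by (intro generate_subgroup_incl H_subgroup) simp
    then show ?thesis using that by blast
  qed
  have H1: "H k #> \<one> = H k" for k using coset_join2[OF _ H_subgroup] subgroup.one_closed[OF H_subgroup] by simp
  have oneH: "\<one> \<in> H k" for k by (rule subgroup.one_closed[OF H_subgroup])
  define p where "p D \<longleftrightarrow> (\<forall>k. - 1 \<le> k \<and> k \<le> int n \<and> k \<noteq> ?i \<and> k \<noteq> ?j \<longrightarrow> face Q D k = (k, H k)) \<and>
     (\<exists>g\<in>?Z. face Q D ?i = (?i, H ?i #> g) \<and>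
        (face Q D ?j = (?j, H ?j #> g) \<or> face Q D ?j = (?j, H ?j #> (s m \<otimes> g))))" for D
  have le0: "((?i, H ?i #> g), (?j, H ?j #> g)) \<in> le_rel Q" if "g \<in> ?Z" for g
    by (rule coset_leI[of _ _ _ _ g]) (use that m Z.mem_carrier oneH in auto)
  have le1: "((?i, H ?i #> g), (?j, H ?j #> (s m \<otimes> g))) \<in> le_rel Q" if g: "g \<in> ?Z" for g
  \<comment> \<open>This element is common to both cosets: \<open>s (m - 1) \<otimes> s m\<close>
    avoids rank \<open>m - 1\<close>, and \<open>s (m - 1)\<close> avoids rank
    \<open>m\<close>.\<close>
  proof (rule coset_leI[of _ _ _ _ "s (m - 1) \<otimes> s m \<otimes> g"])
    have gc: "g \<in> carrier G" using g Z.mem_carrier by blast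
    have "s (m - 1) \<otimes> s m \<in> H ?i" using gen_pair_in_H[of "m - 1"] m by (simp add: of_nat_diff)
    then show "s (m - 1) \<otimes> s m \<otimes> g \<otimes> inv g \<in> H ?i" using gc sm sm' by (simp add: m_assoc)
    have "s (m - 1) \<in> H ?j" by (rule gen_in_H) (use m in auto)
    moreover have "s (m - 1) \<otimes> s m \<otimes> g \<otimes> inv (s m \<otimes> g) = s (m - 1)"
      using gc sm sm' by (simp add: m_assoc)
    ultimately show "s (m - 1) \<otimes> s m \<otimes> g \<otimes> inv (s m \<otimes> g) \<in> H ?j" by simp
  qed (use g m Z.mem_carrier sm sm' in auto)
  have leF: "((?i - 1, H (?i - 1)), (?i, H ?i #> g)) \<in> le_rel Q" if "g \<in> ?Z" for g
    using coset_leI[of "?i - 1" ?i \<one> g g] that m Z.mem_carrier oneH ZH[of "?i - 1" g] by (auto simp: H1)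
  have leG: "((?j, H ?j #> g), (?j + 1, H (?j + 1))) \<in> le_rel Q" if "g \<in> ?Z" for g
    using coset_leI[of ?j "?j + 1" g \<one> g] that m Z.mem_carrier oneH ZH[of "?j + 1" g] by (auto simp: H1)
  have ne: "H k #> (s m \<otimes> g) \<noteq> H k #> g" if "g \<in> ?Z" "s m \<notin> H k" for g k
    using H_coset_eq_iff[of "s m \<otimes> g" g k] that Z.mem_carrier sm by (auto simp: m_assoc)
  have step: "p (adj_flag Q D j)" if D: "flag Q D" "p D" and j: "0 \<le> j" "j < int n"
    and sub: "coset_flag \<one> \<inter> coset_flag x \<subseteq> adj_flag Q D j" for D j
  proof -
    let ?E = "adj_flag Q D j"
    note E = Q.flag_adj[OF D(1) j]
    obtain g where g: "g \<in> ?Z" "face Q D ?i = (?i, H ?i #> g)"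
      "face Q D ?j = (?j, H ?j #> g) \<or> face Q D ?j = (?j, H ?j #> (s m \<otimes> g))"
      and Dk: "\<And>k. - 1 \<le> k \<Longrightarrow> k \<le> int n \<Longrightarrow> k \<noteq> ?i \<Longrightarrow> k \<noteq> ?j \<Longrightarrow> face Q D k = (k, H k)"
      using D(2) unfolding p_def by blast
    have gc: "g \<in> carrier G" using g Z.mem_carrier by blast
    have sg: "s m \<otimes> g \<in> ?Z" using g smZ by blast
    \<comment> \<open>Since \<open>x\<close> lies in \<open>H k\<close>, the base flag and its
      translate share this face, and the path keeps every shared face.\<close>
    have Ek: "face Q ?E k = (k, H k)" if k: "- 1 \<le> k" "k \<le> int n" "k \<noteq> ?i" "k \<noteq> ?j" for k
    proof (rule Q.face_eqI[OF E])
      have "H k #> x = H k" using coset_join2[OF x(1) H_subgroup] x(2) k by blast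
      then have "(k, H k) \<in> coset_flag \<one> \<inter> coset_flag x"
        using k by (auto simp: coset_flag_def image_iff H1)
      then show "(k, H k) \<in> ?E" using sub by blast
    qed (rule rk_Q)
    have "j = ?i \<or> j = ?j"
      using Q.face_adj_same[OF D(1) j] Ek[of j] Dk[of j] j by force
    then show ?thesis
    proof
      assume ji: "j = ?i"
      have Ej: "face Q ?E ?j = face Q D ?j" using Q.face_adj_other[OF D(1) j, of ?j] ji m by simp
      \<comment> \<open>The new face is the second one in its diamond, so any coset in that diamond
        other than the old face must equal it.\<close>
      have other: "face Q ?E ?i = (?i, H ?i #> g')"
        if g': "g' \<in> ?Z" "((?i, H ?i #> g'), face Q D ?j) \<in> le_rel Q" "H ?i #> g' \<noteq> H ?i #> g" for g'
      proof (rule Q.diamond_three[of "face Q D ?j" "(?i - 1, H (?i - 1))" "face Q D ?i"])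
        have Fi: "(?i - 1, H (?i - 1)) = face Q D (?i - 1)" "(?i - 1, H (?i - 1)) = face Q ?E (?i - 1)"
          using Dk[of "?i - 1"] Ek[of "?i - 1"] m by auto
        show "rk Q (face Q D ?j) = rk Q (?i - 1, H (?i - 1)) + 2"
          "rk Q (face Q D ?i) = rk Q (?i - 1, H (?i - 1)) + 1"
          "rk Q (face Q ?E ?i) = rk Q (?i - 1, H (?i - 1)) + 1"
          "rk Q (?i, H ?i #> g') = rk Q (?i - 1, H (?i - 1)) + 1"
          using Q.rk_face[OF D(1)] Q.rk_face[OF E] m by (simp_all add: rk_Q)
        show "((?i - 1, H (?i - 1)), face Q D ?i) \<in> le_rel Q" "(face Q D ?i, face Q D ?j) \<in> le_rel Q"
          unfolding Fi(1) using Q.face_le[OF D(1)] m by auto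
        show "((?i - 1, H (?i - 1)), face Q ?E ?i) \<in> le_rel Q" "(face Q ?E ?i, face Q D ?j) \<in> le_rel Q"
          unfolding Fi(2) Ej[symmetric] using Q.face_le[OF E] m by auto
        show "((?i - 1, H (?i - 1)), (?i, H ?i #> g')) \<in> le_rel Q" by (rule leF[OF g'(1)])
        show "((?i, H ?i #> g'), face Q D ?j) \<in> le_rel Q" by (rule g'(2))
        show "face Q ?E ?i \<noteq> face Q D ?i" using Q.face_adj_same[OF D(1) j] ji by simp
        show "(?i, H ?i #> g') \<noteq> face Q D ?i" using g(2) g'(3) by simp
      qed
      from g(3) have "\<exists>g\<in>?Z. face Q ?E ?i = (?i, H ?i #> g) \<and>
        (face Q ?E ?j = (?j, H ?j #> g) \<or> face Q ?E ?j = (?j, H ?j #> (s m \<otimes> g)))"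
      proof
        assume 0: "face Q D ?j = (?j, H ?j #> g)"
        \<comment> \<open>Writing \<open>g\<close> as \<open>s m \<otimes> ?g\<close> puts the
          unchanged \<open>m\<close>-face into the second form of the invariant and shows that it is
          incident with \<open>H ?i #> ?g\<close>.\<close>
        let ?g = "inv (s m) \<otimes> g"
        have gg: "?g \<in> ?Z" "s m \<otimes> ?g = g" using g smZ sm gc by (auto simp: m_assoc[symmetric])
        have "face Q ?E ?i = (?i, H ?i #> ?g)"
          by (rule other[OF gg(1)]) (use le1[OF gg(1)] ne[OF gg(1) nin(1)] gg(2) 0 in auto)
        then show ?thesis using gg Ej 0 by metis
      next
        assume 1: "face Q D ?j = (?j, H ?j #> (s m \<otimes> g))"
        have "face Q ?E ?i = (?i, H ?i #> (s m \<otimes> g))"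
          by (rule other[OF sg]) (use le0[OF sg] ne[OF g(1) nin(1)] 1 in auto)
        then show ?thesis using sg Ej 1 by metis
      qed
      then show ?thesis using Ek unfolding p_def by blast
    next
      assume jj: "j = ?j"
      have Ei: "face Q ?E ?i = face Q D ?i" using Q.face_adj_other[OF D(1) j, of ?i] jj m by simp
      have other: "face Q ?E ?j = (?j, H ?j #> g')"
        if g': "g' \<in> ?Z" "(face Q D ?i, (?j, H ?j #> g')) \<in> le_rel Q" "(?j, H ?j #> g') \<noteq> face Q D ?j" for g'
      proof (rule Q.diamond_three[of "(?j + 1, H (?j + 1))" "face Q D ?i" "face Q D ?j"])
        have Fi: "(?j + 1, H (?j + 1)) = face Q D (?j + 1)" "(?j + 1, H (?j + 1)) = face Q ?E (?j + 1)"
          using Dk[of "?j + 1"] Ek[of "?j + 1"] m by auto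
        show "rk Q (?j + 1, H (?j + 1)) = rk Q (face Q D ?i) + 2"
          "rk Q (face Q D ?j) = rk Q (face Q D ?i) + 1"
          "rk Q (face Q ?E ?j) = rk Q (face Q D ?i) + 1"
          "rk Q (?j, H ?j #> g') = rk Q (face Q D ?i) + 1"
          using Q.rk_face[OF D(1)] Q.rk_face[OF E] m by (simp_all add: rk_Q)
        show "(face Q D ?j, (?j + 1, H (?j + 1))) \<in> le_rel Q" "(face Q D ?i, face Q D ?j) \<in> le_rel Q"
          unfolding Fi(1) using Q.face_le[OF D(1)] m by auto
        show "(face Q ?E ?j, (?j + 1, H (?j + 1))) \<in> le_rel Q" "(face Q D ?i, face Q ?E ?j) \<in> le_rel Q"
          unfolding Fi(2) Ei[symmetric] using Q.face_le[OF E] m by auto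
        show "((?j, H ?j #> g'), (?j + 1, H (?j + 1))) \<in> le_rel Q" by (rule leG[OF g'(1)])
        show "(face Q D ?i, (?j, H ?j #> g')) \<in> le_rel Q" by (rule g'(2))
        show "face Q ?E ?j \<noteq> face Q D ?j" using Q.face_adj_same[OF D(1) j] jj by simp
        show "(?j, H ?j #> g') \<noteq> face Q D ?j" by (rule g'(3))
      qed
      \<comment> \<open>A change at rank \<open>m\<close> switches between the two forms of the
        invariant while \<open>g\<close> stays the same.\<close>
      from g(3) have "face Q ?E ?j = (?j, H ?j #> g) \<or> face Q ?E ?j = (?j, H ?j #> (s m \<otimes> g))"
      proof
        assume 0: "face Q D ?j = (?j, H ?j #> g)"
        have "face Q ?E ?j = (?j, H ?j #> (s m \<otimes> g))"
          by (rule other[OF sg]) (use le1[OF g(1)] ne[OF g(1) nin(2)] g(2) 0 in auto)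
        then show ?thesis by blast
      next
        assume 1: "face Q D ?j = (?j, H ?j #> (s m \<otimes> g))"
        have "face Q ?E ?j = (?j, H ?j #> g)"
          by (rule other[OF g(1)]) (use le0[OF g(1)] ne[OF g(1) nin(2)] g(2) 1 in auto)
        then show ?thesis by blast
      qed
      then show ?thesis using Ek Ei g(1,2) unfolding p_def by metis
    qed
  qed
  have "p (coset_flag \<one>)"
  proof -
    have "\<one> \<in> ?Z" by (rule generate.one)
    moreover have "face Q (coset_flag \<one>) k = (k, H k #> \<one>)" if "- 1 \<le> k" "k \<le> int n" for k
      using face_coset_flag that by simp
    ultimately show ?thesis unfolding p_def using m by (auto simp: H1 intro!: bexI[of _ \<one>])
  qed
  then have "p (coset_flag x)"
    using Q.flags_induct[of "coset_flag \<one>" "coset_flag x" p] coset_flag x(1) step by blast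
  then obtain g where g: "g \<in> ?Z" "face Q (coset_flag x) ?i = (?i, H ?i #> g)"
      "face Q (coset_flag x) ?j = (?j, H ?j #> g) \<or> face Q (coset_flag x) ?j = (?j, H ?j #> (s m \<otimes> g))"
    unfolding p_def by blast
  have gc: "g \<in> carrier G" using g Z.mem_carrier by blast
  have "H ?i #> x = H ?i #> g" "H ?j #> x = H ?j #> g \<or> H ?j #> x = H ?j #> (s m \<otimes> g)"
    using g(2,3) face_coset_flag[OF x(1)] m by auto
  then have "x \<otimes> inv g \<in> H ?i" "x \<otimes> inv g \<in> H ?j \<or> x \<otimes> inv (s m \<otimes> g) \<in> H ?j"
    using H_coset_eq_iff[OF x(1) gc] H_coset_eq_iff[OF x(1), of "s m \<otimes> g"] gc sm by auto
  then show ?thesis using g(1) by blast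
qed

section \<open>The mix of a polytope with its dual\<close>

lemma tau_DirProd: "tau (G1 \<times>\<times> G2) (\<lambda>i. (s i, t i)) i j = (tau G1 s i j, tau G2 t i j)"
proof -
  have "foldr (\<lambda>k x. (s k, t k) \<otimes>\<^bsub>G1 \<times>\<times> G2\<^esub> x) ks \<one>\<^bsub>G1 \<times>\<times> G2\<^esub> =
      (foldr (\<lambda>k x. s k \<otimes>\<^bsub>G1\<^esub> x) ks \<one>\<^bsub>G1\<^esub>, foldr (\<lambda>k x. t k \<otimes>\<^bsub>G2\<^esub> x) ks \<one>\<^bsub>G2\<^esub>)" for ks
    by (induction ks) (simp_all add: DirProd_def)
  then show ?thesis unfolding tau_def by blast
qed

lemma tau_update_carrier: "tau (G\<lparr>carrier := K\<rparr>) s i j = tau G s i j"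
  by (simp add: tau_def)

text \<open>By Bezout some multiple of \<open>ord w\<close> exceeds a multiple of
  \<open>ord v\<close> by one.\<close>

lemma (in group) coprime_orders_pow:
  assumes "v \<in> carrier G" "w \<in> carrier G" "ord w \<noteq> 0" "coprime (ord v) (ord w)"
  obtains e :: nat where "v [^] e = v" "w [^] e = \<one>"
proof -
  obtain a b where ab: "ord w * a = ord v * b + gcd (ord w) (ord v)"
    using bezout_nat[of "ord w" "ord v"] assms(3) by blast
  have e: "ord w * a = Suc (ord v * b)"
    using ab assms(4) by (simp add: coprime_iff_gcd_eq_1 gcd.commute)
  have "v [^] (ord w * a) = v [^] (ord v * b) \<otimes> v" by (simp add: e)
  moreover have "v [^] (ord v * b) = \<one>" "w [^] (ord w * a) = \<one>"
    using assms(1,2) by (simp_all add: nat_pow_pow[symmetric] pow_ord_eq_1)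
  ultimately show ?thesis using that[of "ord w * a"] assms(1) by simp
qed

text \<open>The power \<open>e\<close> of the given pair keeps its first component and kills the
  second.\<close>

lemma DirProd_coprime_component:
  assumes "group G1" "group G2" "subgroup H ((G1 \<times>\<times> G2)\<lparr>carrier := K\<rparr>)"
    and vw: "(v, inv\<^bsub>G2\<^esub> w) \<in> H" "v \<in> carrier G1" "w \<in> carrier G2"
    and e: "v [^]\<^bsub>G1\<^esub> (e :: nat) = v" "w [^]\<^bsub>G2\<^esub> e = \<one>\<^bsub>G2\<^esub>"
  shows "(v, \<one>\<^bsub>G2\<^esub>) \<in> H"
proof -
  interpret G1: group G1 by fact
  interpret G2: group G2 by fact
  interpret H: subgroup H "(G1 \<times>\<times> G2)\<lparr>carrier := K\<rparr>" by fact
  have "(v [^]\<^bsub>G1\<^esub> k, (inv\<^bsub>G2\<^esub> w) [^]\<^bsub>G2\<^esub> k) \<in> H" for k :: nat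
  proof (induction k)
    case 0
    show ?case using H.one_closed by (simp add: DirProd_def)
  next
    case (Suc k)
    show ?case using H.m_closed[OF Suc vw(1)] by simp
  qed
  from this[of e] show ?thesis using e vw by (simp add: G2.nat_pow_inv)
qed

text \<open>Every element generated is a power of \<open>v\<close> paired with its inverse; the
  conclusion keeps what the final case distinction uses.\<close>

lemma (in group) generate_antidiagonal:
  assumes "v \<in> carrier G" "g \<in> generate (G \<times>\<times> G) {(v, inv v)}"
  shows "\<exists>f \<in> carrier G. f \<otimes> v = v \<otimes> f \<and> g = (f, inv f)"
proof -
  have "\<exists>k::int. g = (v [^] k, inv v [^] k)"
    using assms(2)
  proof (induction rule: generate.induct)
    case one
    show ?case by (rule exI[of _ 0]) simp
  next
    case (incl h)
    then show ?case using assms(1) by (intro exI[of _ 1]) (simp add: int_pow_1)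
  next
    case (inv h)
    then show ?case using assms(1) is_group
      by (intro exI[of _ "- 1"]) (simp add: int_pow_neg int_pow_1)
  next
    case (eng h1 h2)
    then obtain k l :: int where "h1 = (v [^] k, inv v [^] k)" "h2 = (v [^] l, inv v [^] l)" by blast
    then show ?case using assms(1) by (intro exI[of _ "k + l"]) (simp add: int_pow_mult)
  qed
  then obtain k :: int where k: "g = (v [^] k, inv v [^] k)" by blast
  have "v [^] k \<otimes> v = v [^] (k + 1)" "v \<otimes> v [^] k = v [^] (1 + k)"
    using assms(1) by (simp_all add: int_pow_mult int_pow_1)
  then have "v [^] k \<otimes> v = v \<otimes> v [^] k" by (simp add: add.commute)
  then show ?thesis using k assms(1) by (intro bexI[of _ "v [^] k"]) (simp_all add: int_pow_inv)
qed

section \<open>Inverses and involutions among automorphisms\<close>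

context abstract_polytope
begin

lemma turn_inverse:
  assumes C: "flag P C" and sym: "chiral P \<or> regular P"
    and i: "0 \<le> i" "i < int n" and j: "0 \<le> j" "j < int n"
  shows "turn P C j i = inv\<^bsub>A\<^esub> (turn P C i j)"
proof -
  note f = turn_closed[OF C sym i j] turn_image[OF C sym i j]
  note g = turn_closed[OF C sym j i] turn_image[OF C sym j i]
  note ai = flag_adj[OF C i] and aj = flag_adj[OF C j]
  have "(turn P C j i \<otimes>\<^bsub>A\<^esub> turn P C i j) ` C = turn P C i j ` adj_flag P (adj_flag P C j) i"
    using aut_mult_image[OF C] g(2) by simp
  also have "\<dots> = adj_flag P (adj_flag P (adj_flag P (adj_flag P C i) j) j) i"
    using adj_image[OF f(1) aj i] adj_image[OF f(1) C j] f(2) by simp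
  also have "\<dots> = C" using adj_adj[OF ai j] adj_adj[OF C i] by simp
  finally have "turn P C j i \<otimes>\<^bsub>A\<^esub> turn P C i j = \<one>\<^bsub>A\<^esub>"
    using aut_eqI[OF _ _ C] f(1) g(1) aut_one_image[OF C] by simp
  then show ?thesis using A.inv_equality[OF _ f(1) g(1)] by simp
qed

text \<open>Changes at ranks at least two apart commute, so making both twice restores the flag.
  This gives the relation for products of consecutive generators.\<close>

lemma involution_of_far_ranks:
  assumes C: "flag P C" and f: "f \<in> carrier A" "f ` C = adj_flag P (adj_flag P C j) i"
    and ij: "0 \<le> i" "i + 2 \<le> j" "j < int n"
  shows "f \<otimes>\<^bsub>A\<^esub> f = \<one>\<^bsub>A\<^esub>"
proof -
  have i: "0 \<le> i" "i < int n" and j: "0 \<le> j" "j < int n" using ij by auto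
  note ai = flag_adj[OF C i] and aj = flag_adj[OF C j]
  have "(f \<otimes>\<^bsub>A\<^esub> f) ` C = adj_flag P (adj_flag P (adj_flag P (adj_flag P C j) i) j) i"
    using aut_mult_image[OF C] f adj_image[OF f(1) aj i] adj_image[OF f(1) C j] by simp
  also have "\<dots> = adj_flag P (adj_flag P (adj_flag P (adj_flag P C i) j) j) i"
    using adj_commute[OF C ij] by simp
  also have "\<dots> = C" using adj_adj[OF ai j] adj_adj[OF C i] by simp
  finally show ?thesis using aut_eqI[OF _ _ C] f(1) aut_one_image[OF C] by simp
qed

text \<open>Conjugation by \<open>h\<close>, which acts as the reflection at rank \<open>i\<close>,
  turns \<open>f\<close> into its inverse; as the two commute, \<open>f\<close> equals its
  inverse.\<close>

lemma involution_of_commuting_reflection: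
  assumes C: "flag P C" and f: "f \<in> carrier A" "f ` C = adj_flag P (adj_flag P C i) j"
    and h: "h \<in> carrier A" "h ` C = adj_flag P C i" and comm: "h \<otimes>\<^bsub>A\<^esub> f = f \<otimes>\<^bsub>A\<^esub> h"
    and i: "0 \<le> i" "i < int n" and j: "0 \<le> j" "j < int n"
  shows "f \<otimes>\<^bsub>A\<^esub> f = \<one>\<^bsub>A\<^esub>"
proof -
  note ai = flag_adj[OF C i] and aj = flag_adj[OF C j]
  have "(h \<otimes>\<^bsub>A\<^esub> f) ` C = adj_flag P (adj_flag P (adj_flag P C i) j) i"
    using aut_mult_image[OF C] f h adj_image[OF f(1) C i] by simp
  moreover have "(f \<otimes>\<^bsub>A\<^esub> h) ` C = adj_flag P C j"
    using aut_mult_image[OF C] f h adj_image[OF h(1) ai j] adj_image[OF h(1) C i] adj_adj[OF C i] by simp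
  ultimately have "adj_flag P (adj_flag P (adj_flag P C i) j) i = adj_flag P C j" using comm by simp
  moreover have "(f \<otimes>\<^bsub>A\<^esub> f) ` C = adj_flag P (adj_flag P (adj_flag P (adj_flag P C i) j) i) j"
    using aut_mult_image[OF C] f adj_image[OF f(1) ai j] adj_image[OF f(1) C i] by simp
  ultimately have "(f \<otimes>\<^bsub>A\<^esub> f) ` C = C" using adj_adj[OF C j] by simp
  then show ?thesis using aut_eqI[OF _ _ C] f(1) aut_one_image[OF C] by simp
qed

end

theorem theorem4p2:
  fixes P :: "'f ranked_poset" and \<Phi> :: "'f set" and n m :: nat and p :: "nat \<Rightarrow> enat"
  assumes "polytope n P"
    and "flag P \<Phi>"
    and "chiral P \<or> directly_regular n P \<Phi>"
    and "has_type n P \<Phi> p"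
    and "even n" and "n \<ge> 4" and "m = n div 2"
    and "relatively_prime (p (m - 1)) (p (m + 1))"
    and "p m \<ge> 3"
  shows "\<not> polytope n (mix n P \<Phi> (dual n P) \<Phi>)"
proof
  assume poly: "polytope n (mix n P \<Phi> (dual n P) \<Phi>)"
  interpret abstract_polytope n P by unfold_locales (rule assms(1))
  have nm: "n = 2 * m" "2 \<le> m" using assms(5-7) by auto
  note C = assms(2)
  have sym: "chiral P \<or> regular P" using assms(3) by (auto simp: directly_regular_def)
  define s where "s = sigma P \<Phi>"
  define t where "t = sigma (dual n P) \<Phi>"
  define b where "b = mix_gen P \<Phi> (dual n P) \<Phi>"
  have b_eq: "b = (\<lambda>i. (s i, t i))" by (simp add: b_def s_def t_def mix_gen_def fun_eq_iff)
  have s: "s i \<in> carrier A" "s i ` \<Phi> = adj_flag P (adj_flag P \<Phi> (int i)) (int i - 1)"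
    if "1 \<le> i" "i \<le> n - 1" for i
    using turn_props[OF C sym, of "int i" "int i - 1"] that by (auto simp: s_def sigma_turn)
  have t: "t i \<in> carrier A" "t i ` \<Phi> = adj_flag P (adj_flag P \<Phi> (int n - 1 - int i)) (int n - int i)"
    if "1 \<le> i" "i \<le> n - 1" for i
    using turn_props[OF C sym, of "int n - 1 - int i" "int n - int i"] that
    by (auto simp: t_def sigma_dual_turn)
  \<comment> \<open>A dual generator makes the two rank changes of \<open>s (n - i)\<close> in the
    opposite order, hence it is the inverse.\<close>
  have t_inv: "t i = inv\<^bsub>A\<^esub> (s (n - i))" if "1 \<le> i" "i \<le> n - 1" for i
  proof -
    have "t i = turn P \<Phi> (int n - 1 - int i) (int n - int i)"
      by (simp only: t_def sigma_dual_turn)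
    moreover have "int (n - i) = int n - int i" using that by auto
    then have "s (n - i) = turn P \<Phi> (int n - int i) (int n - int i - 1)"
      by (simp only: s_def sigma_turn)
    moreover have "int n - int i - 1 = int n - 1 - int i" by simp
    ultimately show ?thesis
      using turn_inverse[OF C sym, of "int n - int i" "int n - 1 - int i"] that by simp
  qed

  \<comment> \<open>The mix group and its face subgroups\<close>
  define B where "B = A \<times>\<times> A"
  define K where "K = generate B (b ` {1..n - 1})"
  interpret B: group B unfolding B_def by (intro DirProd_group aut_group_is_group)
  have bB: "b ` {1..n - 1} \<subseteq> carrier B" using s(1) t(1) by (auto simp: b_eq B_def)
  have K: "subgroup K B" unfolding K_def by (rule B.generate_is_subgroup[OF bB])
  define M where "M = B\<lparr>carrier := K\<rparr>"
  have "s ` {1..n - 1} \<subseteq> carrier A" "t ` {1..n - 1} \<subseteq> carrier A" using s(1) t(1) by auto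
  then have M: "mix_group n P \<Phi> (dual n P) \<Phi> = M"
    using mix_group_eq[of P \<Phi> n "dual n P" \<Phi>]
    by (simp only: M_def K_def B_def b_def s_def t_def aut_group_dual)
  have bK: "b i \<in> K" if "1 \<le> i" "i \<le> n - 1" for i
    unfolding K_def by (rule generate.incl) (use that in auto)
  interpret M: coset_polytope M n b
  proof (intro coset_polytope.intro generated_group.intro generated_group_axioms.intro
      coset_polytope_axioms.intro)
    show "group M" unfolding M_def by (rule B.subgroup_imp_group[OF K])
    show "b i \<in> carrier M" if "1 \<le> i" "i \<le> n - 1" for i using bK that by (simp add: M_def)
    show "polytope n (coset_poset n M b)" using poly by (simp add: mix_def M b_def)
  qed
  have M_mult: "(f, f') \<otimes>\<^bsub>M\<^esub> (g, g') = (f \<otimes>\<^bsub>A\<^esub> g, f' \<otimes>\<^bsub>A\<^esub> g')" for f f' g g'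
    by (simp add: M_def B_def)
  have M_inv: "inv\<^bsub>M\<^esub> (f, f') = (inv\<^bsub>A\<^esub> f, inv\<^bsub>A\<^esub> f')" if "(f, f') \<in> carrier M" for f f'
  proof -
    have "(f, f') \<in> K" using that by (simp add: M_def)
    moreover from this have "(f, f') \<in> carrier B" using subgroup.subset[OF K] by blast
    ultimately show ?thesis using B.m_inv_consistent[OF K] inv_DirProd[OF aut_group_is_group aut_group_is_group]
      by (simp add: M_def B_def)
  qed

  txt \<open>A generator \<open>\<tau>\<^bsub>i,j\<^esub>\<close> of \<open>H\<^sub>k\<close> takes \<open>\<Phi>\<close> to \<open>(\<Phi>\<^sup>j)\<^bsup>i-1\<^esup>\<close> in the first component, and to
    \<open>(\<Phi>\<^bsup>n-1-j\<^esup>)\<^bsup>n-i\<^esup>\<close> in the second.\<close>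
  have H_fix: "f \<in> carrier A \<and> f' \<in> carrier A \<and> f (face P \<Phi> k) = face P \<Phi> k \<and>
      f' (face P \<Phi> (int n - 1 - k)) = face P \<Phi> (int n - 1 - k)"
    if "(f, f') \<in> M.H k" "0 \<le> k" "k < int n" for f f' k
  proof -
    let ?F = "face P \<Phi> k" and ?F' = "face P \<Phi> (int n - 1 - k)"
    let ?S = "{f \<in> carrier A. f ?F = ?F} \<times> {f \<in> carrier A. f ?F' = ?F'}"
    let ?T = "{tau M b i j |i j. 1 \<le> i \<and> i \<le> j \<and> j \<le> n - 1 \<and>
      int i - 1 \<in> {0..int n - 1} - {k} \<and> int j \<in> {0..int n - 1} - {k}}"
    have "?F \<in> faces P" "?F' \<in> faces P" using flag_faces[OF C] face_in[OF C] that by auto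
    then have S: "subgroup ?S B"
      unfolding B_def by (intro DirProd_subgroups aut_group_is_group stabilizer_subgroup)
    have "?T \<subseteq> ?S"
    proof
      fix h assume "h \<in> ?T"
      then obtain i j where h: "h = tau M b i j" and ij: "1 \<le> i" "i \<le> j" "j \<le> n - 1"
        "int i - 1 \<noteq> k" "int j \<noteq> k" by blast
      have "h = (tau A s i j, tau A t i j)"
        unfolding h M_def tau_update_carrier B_def b_eq tau_DirProd ..
      moreover have "tau A s i j \<in> carrier A" "tau A t i j \<in> carrier A"
        using s(1) t(1) ij by (auto intro!: A.tau_closed)
      moreover have "tau A s i j ?F = ?F"
        by (rule tau_fixes_face[where a = int, OF C]) (use s ij that in \<open>auto simp: of_nat_diff\<close>)
      moreover have "tau A t i j ?F' = ?F'"
        by (rule tau_fixes_face[where a = "\<lambda>k. int n - 1 - int k", OF C])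
          (use t ij that in \<open>auto simp: of_nat_diff\<close>)
      ultimately show "h \<in> ?S" by simp
    qed
    moreover have "?T \<subseteq> K"
      using M.tau_closed[of _ _ b] bK by (auto simp: M_def)
    then have "M.H k = generate B ?T"
      unfolding face_stab_def sub_gen_def using B.generate_consistent[OF _ K] by (simp add: M_def)
    ultimately have "M.H k \<subseteq> ?S" using B.generate_subgroup_incl[OF _ S] by simp
    then show ?thesis using that(1) by blast
  qed

  \<comment> \<open>The middle generator and its neighbours\<close>
  let ?\<sigma> = "s m" and ?i = "int m - 1" and ?j = "int m"
  have ij: "0 \<le> ?i" "?i < int n" "0 \<le> ?j" "?j < int n" using nm by auto
  have \<sigma>: "?\<sigma> \<in> carrier A" "?\<sigma> ` \<Phi> = adj_flag P (adj_flag P \<Phi> ?j) ?i" using s nm by auto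
  have bm: "b m = (?\<sigma>, inv\<^bsub>A\<^esub> ?\<sigma>)" using t_inv[of m] nm by (simp add: b_eq)
  \<comment> \<open>This fact and the next show that \<open>s m\<close> moves both middle faces of
    \<open>\<Phi>\<close>, which keeps \<open>b m\<close> out of the two middle face
    subgroups.\<close>
  have \<sigma>_face: "?\<sigma> (face P \<Phi> ?j) = face P (adj_flag P \<Phi> ?j) ?j"
    using face_image[OF \<sigma>(1) C, of ?j] \<sigma>(2) face_adj_other[OF flag_adj[OF C ij(3,4)] ij(1,2), of ?j] ij by simp
  have \<sigma>_face': "?\<sigma> (face P \<Phi> ?i) \<noteq> face P \<Phi> ?i"
    using face_image[OF \<sigma>(1) C, of ?i] \<sigma>(2) face_adj_same[OF flag_adj[OF C ij(3,4)] ij(1,2)]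
      face_adj_other[OF C ij(3,4), of ?i] ij by simp
  have \<sigma>_not_inv: "?\<sigma> \<otimes>\<^bsub>A\<^esub> ?\<sigma> \<noteq> \<one>\<^bsub>A\<^esub>"
  proof
    assume "?\<sigma> \<otimes>\<^bsub>A\<^esub> ?\<sigma> = \<one>\<^bsub>A\<^esub>"
    then have "A.ord ?\<sigma> dvd 2" using A.pow_eq_id[OF \<sigma>(1), of 2] \<sigma>(1) by (simp add: numeral_2_eq_2)
    \<comment> \<open>Order \<open>0\<close> encodes infinite order and does not divide
      \<open>2\<close>, so \<open>p m\<close> would be finite and at most \<open>2\<close>.\<close>
    then have "A.ord ?\<sigma> \<le> 2" "A.ord ?\<sigma> \<noteq> 0" by (auto dest: dvd_imp_le intro: ccontr)
    moreover have "p m = elem_order A ?\<sigma>" using assms(4) nm by (simp add: has_type_def s_def)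
    ultimately have "p m \<le> 2" by (simp add: elem_order_def numeral_eq_enat)
    then have "(3::enat) \<le> 2" using assms(9) by (rule order.trans[rotated])
    then show False by simp
  qed

  let ?v = "s (m - 1)" and ?w = "s (m + 1)"
  have vw: "?v \<in> carrier A" "?w \<in> carrier A" using s(1) nm by auto
  obtain a c where ac: "p (m - 1) = enat a" "p (m + 1) = enat c" "coprime a c"
    using assms(8) by (auto simp: relatively_prime_def)
  have "p i = elem_order A (s i)" if "1 \<le> i" "i \<le> n - 1" for i
    using assms(4) that by (simp add: has_type_def s_def)
  from this[of "m - 1"] this[of "m + 1"]
  have "elem_order A ?v = enat a" "elem_order A ?w = enat c" using nm ac by simp_all
  \<comment> \<open>\<open>relatively_prime\<close> holds for finite values only, which excludes the
    default order \<open>0\<close>.\<close>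
  then have ords: "A.ord ?v \<noteq> 0" "A.ord ?w \<noteq> 0" "coprime (A.ord ?v) (A.ord ?w)"
    using ac(3) by (auto simp: elem_order_def split: if_splits)
  have pair_inv: "(s i \<otimes>\<^bsub>A\<^esub> s (i + 1)) \<otimes>\<^bsub>A\<^esub> (s i \<otimes>\<^bsub>A\<^esub> s (i + 1)) = \<one>\<^bsub>A\<^esub>"
    if i: "1 \<le> i" "i + 1 \<le> n - 1" for i
  proof (rule involution_of_far_ranks[OF C])
    have "tau A s i (i + 1) \<in> carrier A \<and> tau A s i (i + 1) ` \<Phi> = adj_flag P (adj_flag P \<Phi> (int (i + 1))) (int (i - 1))"
      by (rule tau_image[where a = int, OF C]) (use s i in \<open>auto simp: of_nat_diff\<close>)
    then show "s i \<otimes>\<^bsub>A\<^esub> s (i + 1) \<in> carrier A"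
      "(s i \<otimes>\<^bsub>A\<^esub> s (i + 1)) ` \<Phi> = adj_flag P (adj_flag P \<Phi> (int i + 1)) (int i - 1)"
      using s(1)[of "i + 1"] i by (simp_all add: tau_def of_nat_diff algebra_simps)
  qed (use i in auto)

  \<comment> \<open>The element \<open>?x\<close> in the face subgroups\<close>
  let ?x = "(\<one>\<^bsub>A\<^esub>, inv\<^bsub>A\<^esub> ?\<sigma> \<otimes>\<^bsub>A\<^esub> inv\<^bsub>A\<^esub> ?\<sigma>)"
  have x: "?x \<in> M.H k" if k: "k \<noteq> ?i" "k \<noteq> ?j" for k
  proof -
    have bmH: "(?\<sigma>, inv\<^bsub>A\<^esub> ?\<sigma>) \<in> M.H k" using M.gen_in_H[of m k] k nm bm by auto
    have H: "subgroup (M.H k) ((A \<times>\<times> A)\<lparr>carrier := K\<rparr>)"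
      using M.H_subgroup[of k] by (simp add: M_def B_def)
    note cl = subgroup.m_closed[OF M.H_subgroup[of k]]
    show ?thesis
    \<comment> \<open>\<open>b (m - 1)\<close> has labels \<open>m - 2\<close> and
      \<open>m - 1\<close>, so it is available unless \<open>k = m - 2\<close>; there
      \<open>b (m + 1)\<close>, with labels \<open>m\<close> and \<open>m + 1\<close>, takes its
      place.\<close>
    proof (cases "k = ?i - 1")
      case False
      obtain e :: nat where e: "?v [^]\<^bsub>A\<^esub> e = ?v" "?w [^]\<^bsub>A\<^esub> e = \<one>\<^bsub>A\<^esub>"
        using A.coprime_orders_pow[OF vw] ords by blast
      have "b (m - 1) \<in> M.H k" by (rule M.gen_in_H) (use False k nm in auto)
      then have "(?v, inv\<^bsub>A\<^esub> ?w) \<in> M.H k" using t_inv[of "m - 1"] nm by (simp add: b_eq)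
      then have "(?v, \<one>\<^bsub>A\<^esub>) \<in> M.H k"
        by (rule DirProd_coprime_component[OF aut_group_is_group aut_group_is_group H _ vw e])
      from cl[OF this bmH] have "(?v \<otimes>\<^bsub>A\<^esub> ?\<sigma>, inv\<^bsub>A\<^esub> ?\<sigma>) \<in> M.H k" using \<sigma>(1) by (simp add: M_mult)
      from cl[OF this this] show ?thesis using pair_inv[of "m - 1"] nm by (simp add: M_mult)
    next
      case True
      obtain e :: nat where e: "?w [^]\<^bsub>A\<^esub> e = ?w" "?v [^]\<^bsub>A\<^esub> e = \<one>\<^bsub>A\<^esub>"
        using A.coprime_orders_pow[OF vw(2,1)] ords by (metis coprime_commute)
      have "b (m + 1) \<in> M.H k" by (rule M.gen_in_H) (use True nm in auto)
      then have "(?w, inv\<^bsub>A\<^esub> ?v) \<in> M.H k" using t_inv[of "m + 1"] nm by (simp add: b_eq)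
      then have "(?w, \<one>\<^bsub>A\<^esub>) \<in> M.H k"
        by (rule DirProd_coprime_component[OF aut_group_is_group aut_group_is_group H _ vw(2,1) e])
      from cl[OF bmH this] have "(?\<sigma> \<otimes>\<^bsub>A\<^esub> ?w, inv\<^bsub>A\<^esub> ?\<sigma>) \<in> M.H k" using \<sigma>(1) by (simp add: M_mult)
      from cl[OF this this] show ?thesis using pair_inv[of m] nm by (simp add: M_mult)
    qed
  qed
  \<comment> \<open>Rank \<open>-1\<close> differs from both middle ranks, so \<open>?x\<close> lies
    in \<open>M.H (- 1)\<close> and thereby in the mix.\<close>
  have xM: "?x \<in> carrier M"
    using x[of "- 1"] subgroup.subset[OF M.H_subgroup[of "- 1"]] nm by auto

  \<comment> \<open>The path to the translate by \<open>?x\<close> and its two outcomes\<close>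
  have "b m \<notin> M.H ?i" using H_fix[of ?\<sigma> "inv\<^bsub>A\<^esub> ?\<sigma>" ?i] \<sigma>_face' bm ij by auto
  moreover have "b m \<notin> M.H ?j"
    using H_fix[of ?\<sigma> "inv\<^bsub>A\<^esub> ?\<sigma>" ?j] \<sigma>_face face_adj_same[OF C ij(3,4)] bm ij by auto
  moreover have "m + 1 \<le> n" using nm by simp
  ultimately obtain g where g: "g \<in> generate M {b m}" "?x \<otimes>\<^bsub>M\<^esub> inv\<^bsub>M\<^esub> g \<in> M.H ?i"
    "?x \<otimes>\<^bsub>M\<^esub> inv\<^bsub>M\<^esub> g \<in> M.H ?j \<or> ?x \<otimes>\<^bsub>M\<^esub> inv\<^bsub>M\<^esub> (b m \<otimes>\<^bsub>M\<^esub> g) \<in> M.H ?j"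
    using M.coset_flag_path[of m ?x] xM x nm(2) by blast
  have bmK: "{b m} \<subseteq> K" using bK[of m] nm by simp
  then have "g \<in> generate (A \<times>\<times> A) {(?\<sigma>, inv\<^bsub>A\<^esub> ?\<sigma>)}"
    using g(1) B.generate_consistent[OF _ K, of "{b m}"] by (simp add: M_def B_def bm)
  then obtain f where f: "f \<in> carrier A" "f \<otimes>\<^bsub>A\<^esub> ?\<sigma> = ?\<sigma> \<otimes>\<^bsub>A\<^esub> f" "g = (f, inv\<^bsub>A\<^esub> f)"
    using A.generate_antidiagonal[OF \<sigma>(1)] by blast
  have gM: "g \<in> carrier M" using M.generate_in_carrier[OF _ g(1)] bmK by (simp add: M_def)
  have bmM: "b m \<in> carrier M" using bmK by (simp add: M_def)
  have y: "?x \<otimes>\<^bsub>M\<^esub> inv\<^bsub>M\<^esub> g = (inv\<^bsub>A\<^esub> f, inv\<^bsub>A\<^esub> ?\<sigma> \<otimes>\<^bsub>A\<^esub> inv\<^bsub>A\<^esub> ?\<sigma> \<otimes>\<^bsub>A\<^esub> f)"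
    using M_inv[of f "inv\<^bsub>A\<^esub> f"] gM f by (simp add: M_mult)
  \<comment> \<open>At rank \<open>m - 1\<close> this comes from the path; at the other ranks both
    \<open>?x\<close> and the power \<open>g\<close> of \<open>b m\<close> lie in the
    subgroup.\<close>
  have yH: "(inv\<^bsub>A\<^esub> f, inv\<^bsub>A\<^esub> ?\<sigma> \<otimes>\<^bsub>A\<^esub> inv\<^bsub>A\<^esub> ?\<sigma> \<otimes>\<^bsub>A\<^esub> f) \<in> M.H k" if "k \<noteq> ?j" for k
  proof (cases "k = ?i")
    case True
    then show ?thesis using g(2) y by simp
  next
    case False
    have "b m \<in> M.H k" by (rule M.gen_in_H) (use False that nm in auto)
    then have "g \<in> M.H k" using M.generate_subgroup_incl[OF _ M.H_subgroup, of "{b m}" k] g(1) by blast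
    then have "inv\<^bsub>M\<^esub> g \<in> M.H k" by (rule subgroup.m_inv_closed[OF M.H_subgroup])
    then show ?thesis using subgroup.m_closed[OF M.H_subgroup x[OF False that]] y by metis
  qed
  let ?h = "inv\<^bsub>A\<^esub> f"
  from g(3) show False
  proof
    \<comment> \<open>First case: the element lies in every face subgroup, so both components fix
      \<open>\<Phi>\<close> and are trivial, and \<open>s m\<close> squares to one.\<close>
    assume "?x \<otimes>\<^bsub>M\<^esub> inv\<^bsub>M\<^esub> g \<in> M.H ?j"
    then have all: "(?h, inv\<^bsub>A\<^esub> ?\<sigma> \<otimes>\<^bsub>A\<^esub> inv\<^bsub>A\<^esub> ?\<sigma> \<otimes>\<^bsub>A\<^esub> f) \<in> M.H k" for k
      using yH[of k] y by (cases "k = ?j") auto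
    have "?h = \<one>\<^bsub>A\<^esub>"
      by (rule aut_fixes_flagI[OF _ C]) (use H_fix[OF all] f(1) in auto)
    then have f1: "f = \<one>\<^bsub>A\<^esub>" using f(1) A.inv_eq_1_iff by simp
    have "inv\<^bsub>A\<^esub> ?\<sigma> \<otimes>\<^bsub>A\<^esub> inv\<^bsub>A\<^esub> ?\<sigma> \<otimes>\<^bsub>A\<^esub> f = \<one>\<^bsub>A\<^esub>"
    proof (rule aut_fixes_flagI[OF _ C])
      fix j assume "0 \<le> j" "j < int n"
      \<comment> \<open>Rank \<open>j\<close> in the second component is controlled by the face
        subgroup of rank \<open>n - 1 - j\<close>.\<close>
      then show "(inv\<^bsub>A\<^esub> ?\<sigma> \<otimes>\<^bsub>A\<^esub> inv\<^bsub>A\<^esub> ?\<sigma> \<otimes>\<^bsub>A\<^esub> f) (face P \<Phi> j) = face P \<Phi> j"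
        using H_fix[OF all, of "int n - 1 - j"] by simp
    qed (use f(1) \<sigma>(1) in simp)
    then have "inv\<^bsub>A\<^esub> (?\<sigma> \<otimes>\<^bsub>A\<^esub> ?\<sigma>) = \<one>\<^bsub>A\<^esub>" using f1 \<sigma>(1) by (simp add: A.inv_mult_group)
    then show False using \<sigma>_not_inv \<sigma>(1) A.inv_eq_1_iff[of "?\<sigma> \<otimes>\<^bsub>A\<^esub> ?\<sigma>"] by simp
  next
    \<comment> \<open>Second case: \<open>?h\<close> sends the \<open>m\<close>-face where
      \<open>s m\<close> sends it and, by \<open>yH\<close>, fixes the other faces, so it acts on
      \<open>\<Phi>\<close> as the reflection at rank \<open>m\<close> while commuting with
      \<open>s m\<close>.\<close>
    assume z: "?x \<otimes>\<^bsub>M\<^esub> inv\<^bsub>M\<^esub> (b m \<otimes>\<^bsub>M\<^esub> g) \<in> M.H ?j"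
    have h: "?h \<in> carrier A" using f(1) by simp
    have bg: "b m \<otimes>\<^bsub>M\<^esub> g = (?\<sigma> \<otimes>\<^bsub>A\<^esub> f, inv\<^bsub>A\<^esub> ?\<sigma> \<otimes>\<^bsub>A\<^esub> ?h)" by (simp add: bm f(3) M_mult)
    have "b m \<otimes>\<^bsub>M\<^esub> g \<in> carrier M" using gM bmM by simp
    then have "?x \<otimes>\<^bsub>M\<^esub> inv\<^bsub>M\<^esub> (b m \<otimes>\<^bsub>M\<^esub> g) =
        (?h \<otimes>\<^bsub>A\<^esub> inv\<^bsub>A\<^esub> ?\<sigma>, inv\<^bsub>A\<^esub> ?\<sigma> \<otimes>\<^bsub>A\<^esub> inv\<^bsub>A\<^esub> ?\<sigma> \<otimes>\<^bsub>A\<^esub> inv\<^bsub>A\<^esub> (inv\<^bsub>A\<^esub> ?\<sigma> \<otimes>\<^bsub>A\<^esub> ?h))"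
      using M_inv f(1) \<sigma>(1) unfolding bg by (simp add: M_mult A.inv_mult_group)
    then have "(?h \<otimes>\<^bsub>A\<^esub> inv\<^bsub>A\<^esub> ?\<sigma>) (face P \<Phi> ?j) = face P \<Phi> ?j"
      using H_fix[of "?h \<otimes>\<^bsub>A\<^esub> inv\<^bsub>A\<^esub> ?\<sigma>" _ ?j] z ij by auto
    moreover have Fj: "face P \<Phi> ?j \<in> faces P" using flag_faces[OF C face_in[OF C]] ij by simp
    moreover have "?h = (?h \<otimes>\<^bsub>A\<^esub> inv\<^bsub>A\<^esub> ?\<sigma>) \<otimes>\<^bsub>A\<^esub> ?\<sigma>" using h \<sigma>(1) by (simp add: A.m_assoc)
    ultimately have hj: "?h (face P \<Phi> ?j) = face P (adj_flag P \<Phi> ?j) ?j"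
      using aut_mult[OF Fj, of "?h \<otimes>\<^bsub>A\<^esub> inv\<^bsub>A\<^esub> ?\<sigma>" ?\<sigma>] \<sigma>_face by metis
    have "?h ` \<Phi> = adj_flag P \<Phi> ?j"
    proof (rule flag_eqI[OF flag_image[OF h C] flag_adj[OF C ij(3,4)]])
      fix k assume k: "- 1 \<le> k" "k \<le> int n"
      note aj = flag_adj[OF C ij(3,4)]
      consider "k = - 1" | "k = int n" | "k = ?j" | "0 \<le> k" "k < int n" "k \<noteq> ?j" using k by linarith
      then show "face P (?h ` \<Phi>) k = face P (adj_flag P \<Phi> ?j) k"
      proof cases
        case 1
        then show ?thesis using least_face[OF flag_image[OF h C] aj] by simp
      next
        case 2
        then show ?thesis using greatest_face[OF flag_image[OF h C] aj] by simp
      next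
        case 3
        then show ?thesis using hj face_image[OF h C k] by simp
      next
        case 4
        then show ?thesis
          using face_adj_other[OF C ij(3,4) k] face_image[OF h C k] H_fix[OF yH] by simp
      qed
    qed
    moreover have "?h \<otimes>\<^bsub>A\<^esub> ?\<sigma> = ?\<sigma> \<otimes>\<^bsub>A\<^esub> ?h"
    proof -
      have "f \<otimes>\<^bsub>A\<^esub> (?\<sigma> \<otimes>\<^bsub>A\<^esub> ?h) = (f \<otimes>\<^bsub>A\<^esub> ?\<sigma>) \<otimes>\<^bsub>A\<^esub> ?h"
        using f(1) h \<sigma>(1) by (simp add: A.m_assoc)
      also have "\<dots> = ?\<sigma>" unfolding f(2) using f(1) \<sigma>(1) by (simp add: A.m_assoc)
      finally show ?thesis using f(1) h \<sigma>(1) by (simp add: A.inv_solve_left')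
    qed
    ultimately show False
      using involution_of_commuting_reflection[OF C \<sigma> h _ _ ij(3,4,1,2)] \<sigma>_not_inv by blast
  qed
qed

end
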